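(* Suppose $q$ is not a root of unity. The category $\mathcal{O}$ of $U_{g,h}$-modules decomposes as a direct sum of full subcategories $$\mathcal{O}=\bigoplus_{\nu\in\mathrm{Hom}_{alg}(\mathbb{K}[C,g^{\pm1},h^{\pm1}],\mathbb{K})}\mathcal{O}(\nu).$$
   Context: $\mathbb{K}$ is an algebraically closed field of characteristic zero, and $q\in\mathbb{K}$ is nonzero with $q^2\neq 1$. $U_{g,h}$ is the unital associative $\mathbb{K}$-algebra generated by $E,F,K^{\pm1},g^{\pm1},h^{\pm1}$ with relations: $KK^{-1}=K^{-1}K=gg^{-1}=g^{-1}g=hh^{-1}=h^{-1}h=1$; $g$ and $h$ commute with each other and with $E,F,K$; $KEK^{-1}=q^2E$; $KFK^{-1}=q^{-2}F$; $EF-FE=\frac{K-K^{-1}g^2}{q-q^{-1}}$. All modules are left modules. Let $C=FE+\frac{qK+q^{-1}K^{-1}g^2}{(q-q^{-1})^2}$; the center of $U_{g,h}$ is $\mathbb{K}[C,g^{\pm1},h^{\pm1}]$. The BGG category $\mathcal{O}$ consists of all finitely generated $U_{g,h}$-modules (with all module homomorphisms) such that: (1) the actions of $K,g,h$ are (simultaneously) diagonalizable with finite-dimensional weight spaces; (2) the action of $B_+$ is locally finite, where $B_+$ is the subalgebra generated by $E,K^{\pm1},g^{\pm1},h^{\pm1}$. For an algebra homomorphism $\nu:\mathbb{K}[C,g^{\pm1},h^{\pm1}]\to\mathbb{K}$, $\mathcal{O}(\nu)$ is the full subcategory of $\mathcal{O}$ of those $M$ such that for all $m\in M$ and all $z\in\mathbb{K}[C,g^{\pm1},h^{\pm1}]$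 there is $n\in\mathbb{N}$ with $(z-\nu(z))^nm=0$. *)

theory Defs
  imports
    "HOL-Algebra.QuotRing"
    "HOL-Algebra.Module"
    "HOL-Algebra.Generated_Rings"
    "HOL-Algebra.Algebraic_Closure_Type"
    "HOL-Computational_Algebra.Computational_Algebra"
    "HOL-Library.Poly_Mapping"
begin

section \<open>The free algebra on the generators\<close>

datatype gh_gen =
  Gen_E | Gen_F | Gen_K | Gen_K_inv | Gen_g | Gen_g_inv | Gen_h | Gen_h_inv

datatype gh_word = Word (letters: "gh_gen list")

text \<open>
  Words form the free monoid, written additively so that the convolution product on
  \<^typ>\<open>gh_word \<Rightarrow>\<^sub>0 'k::field\<close> is the product of the free algebra.
\<close>

instantiation gh_word :: monoid_add
begin

definition zero_gh_word :: gh_word where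
  "0 = Word []"

definition plus_gh_word :: "gh_word \<Rightarrow> gh_word \<Rightarrow> gh_word" where
  "u + v = Word (letters u @ letters v)"

instance
  by standard (auto simp: zero_gh_word_def plus_gh_word_def)

end

type_synonym 'k free_gh = "gh_word \<Rightarrow>\<^sub>0 'k"

definition gen :: "gh_gen \<Rightarrow> 'k::field free_gh" where
  "gen x = Poly_Mapping.single (Word [x]) 1"

definition const :: "'k::field \<Rightarrow> 'k free_gh" where
  "const c = Poly_Mapping.single 0 c"


section \<open>The algebra $U_{g,h}$\<close>

text \<open>Each defining relation $l = r$ is recorded as the element $l - r$ of the free algebra.\<close>

definition gh_relations :: "'k::field \<Rightarrow> 'k free_gh set" where
  "gh_relations q =
    (let E = gen Gen_E; F = gen Gen_F; K = gen Gen_K; K' = gen Gen_K_inv;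
         g = gen Gen_g; g' = gen Gen_g_inv; h = gen Gen_h; h' = gen Gen_h_inv
     in {K * K' - 1, K' * K - 1, g * g' - 1, g' * g - 1, h * h' - 1, h' * h - 1,
         g * h - h * g,
         g * E - E * g, g * F - F * g, g * K - K * g,
         h * E - E * h, h * F - F * h, h * K - K * h,
         K * E * K' - const (q\<^sup>2) * E,
         K * F * K' - const (inverse (q\<^sup>2)) * F,
         (E * F - F * E) - const (1 / (q - inverse q)) * (K - K' * g\<^sup>2)})"

definition gh_ideal :: "'k::field \<Rightarrow> 'k free_gh set" where
  "gh_ideal q = Idl\<^bsub>ring_of_type_algebra\<^esub> (gh_relations q)"

definition U_gh :: "'k::field \<Rightarrow> 'k free_gh set ring" where
  "U_gh q = ring_of_type_algebra Quot (gh_ideal q)"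

definition cls :: "'k::field \<Rightarrow> 'k free_gh \<Rightarrow> 'k free_gh set" where
  "cls q x = gh_ideal q +>\<^bsub>ring_of_type_algebra\<^esub> x"

abbreviation ugen :: "'k::field \<Rightarrow> gh_gen \<Rightarrow> 'k free_gh set" where
  "ugen q x \<equiv> cls q (gen x)"

abbreviation uscal :: "'k::field \<Rightarrow> 'k \<Rightarrow> 'k free_gh set" where
  "uscal q c \<equiv> cls q (const c)"

text \<open>The subalgebra generated by a set: the subring generated by it and the scalars.\<close>

definition subalg :: "'k::field \<Rightarrow> 'k free_gh set set \<Rightarrow> 'k free_gh set set" where
  "subalg q S = generate_ring (U_gh q) (range (uscal q) \<union> S)"

definition casimir :: "'k::field \<Rightarrow> 'k free_gh set" where
  "casimir q = cls q (gen Gen_F * gen Gen_E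
     + const (1 / (q - inverse q)\<^sup>2)
       * (const q * gen Gen_K + const (inverse q) * gen Gen_K_inv * (gen Gen_g)\<^sup>2))"

text \<open>$\mathbb{K}[C, g^{\pm 1}, h^{\pm 1}]$, as a subalgebra of $U_{g,h}$.\<close>

definition Z_gh :: "'k::field \<Rightarrow> 'k free_gh set set" where
  "Z_gh q = subalg q ({casimir q} \<union> ugen q ` {Gen_g, Gen_g_inv, Gen_h, Gen_h_inv})"

definition B_plus :: "'k::field \<Rightarrow> 'k free_gh set set" where
  "B_plus q = subalg q
    (ugen q ` {Gen_E, Gen_K, Gen_K_inv, Gen_g, Gen_g_inv, Gen_h, Gen_h_inv})"

text \<open>
  Homomorphisms are taken to be extensional, so that distinct elements of this set differ
  on \<^term>\<open>Z_gh q\<close>.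
\<close>

definition central_chars :: "'k::field \<Rightarrow> ('k free_gh set \<Rightarrow> 'k) set" where
  "central_chars q =
    {\<nu>. \<nu> \<in> ring_hom ((U_gh q)\<lparr>carrier := Z_gh q\<rparr>) ring_of_type_algebra
       \<and> (\<forall>c. \<nu> (uscal q c) = c) \<and> \<nu> \<in> extensional (Z_gh q)}"


section \<open>Left modules over a (noncommutative) ring\<close>

text \<open>The locale \<^locale>\<open>module\<close> assumes a commutative ring of scalars.\<close>

locale left_module = R?: ring R + M?: abelian_group M
  for R :: "('r, 'c) ring_scheme" (structure) and M :: "('r, 'm) module" (structure) +
  assumes smult_closed:
      "\<lbrakk>a \<in> carrier R; x \<in> carrier M\<rbrakk> \<Longrightarrow> a \<odot>\<^bsub>M\<^esub> x \<in> carrier M"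
    and smult_l_distr:
      "\<lbrakk>a \<in> carrier R; b \<in> carrier R; x \<in> carrier M\<rbrakk> \<Longrightarrow>
        (a \<oplus>\<^bsub>R\<^esub> b) \<odot>\<^bsub>M\<^esub> x = a \<odot>\<^bsub>M\<^esub> x \<oplus>\<^bsub>M\<^esub> b \<odot>\<^bsub>M\<^esub> x"
    and smult_r_distr:
      "\<lbrakk>a \<in> carrier R; x \<in> carrier M; y \<in> carrier M\<rbrakk> \<Longrightarrow>
        a \<odot>\<^bsub>M\<^esub> (x \<oplus>\<^bsub>M\<^esub> y) = a \<odot>\<^bsub>M\<^esub> x \<oplus>\<^bsub>M\<^esub> a \<odot>\<^bsub>M\<^esub> y"
    and smult_assoc:
      "\<lbrakk>a \<in> carrier R; b \<in> carrier R; x \<in> carrier M\<rbrakk> \<Longrightarrow>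
        (a \<otimes>\<^bsub>R\<^esub> b) \<odot>\<^bsub>M\<^esub> x = a \<odot>\<^bsub>M\<^esub> (b \<odot>\<^bsub>M\<^esub> x)"
    and smult_one:
      "x \<in> carrier M \<Longrightarrow> \<one>\<^bsub>R\<^esub> \<odot>\<^bsub>M\<^esub> x = x"

definition left_module_hom ::
    "('r, 'c) ring_scheme \<Rightarrow> ('r, 'm) module \<Rightarrow> ('r, 'n) module \<Rightarrow> ('m \<Rightarrow> 'n) set" where
  "left_module_hom R M N =
    {f. f \<in> carrier M \<rightarrow> carrier N
      \<and> (\<forall>x\<in>carrier M. \<forall>y\<in>carrier M. f (x \<oplus>\<^bsub>M\<^esub> y) = f x \<oplus>\<^bsub>N\<^esub> f y)
      \<and> (\<forall>a\<in>carrier R. \<forall>x\<in>carrier M. f (a \<odot>\<^bsub>M\<^esub> x) = a \<odot>\<^bsub>N\<^esub> f x)}"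

text \<open>
  The ring \<open>R\<close> may be a subring of the ring acting on \<open>M\<close>; for the subring of scalars this
  is the linear span.
\<close>

definition submodule_gen ::
    "('r, 'c) ring_scheme \<Rightarrow> ('r, 'm) module \<Rightarrow> 'm set \<Rightarrow> 'm set" where
  "submodule_gen R M S = \<Inter>{N. submodule N R M \<and> S \<subseteq> N}"

definition finitely_generated ::
    "('r, 'c) ring_scheme \<Rightarrow> ('r, 'm) module \<Rightarrow> bool" where
  "finitely_generated R M \<longleftrightarrow>
    (\<exists>S. finite S \<and> S \<subseteq> carrier M \<and> carrier M = submodule_gen R M S)"

text \<open>Internal direct sum: every element has a unique decomposition of finite support.\<close>

definition is_direct_sum :: "('r, 'm) module \<Rightarrow> 'i set \<Rightarrow> ('i \<Rightarrow> 'm set) \<Rightarrow> bool" where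
  "is_direct_sum M I N \<longleftrightarrow>
    (\<forall>i\<in>I. additive_subgroup (N i) M)
    \<and> (\<forall>m\<in>carrier M. \<exists>!x. x \<in> (\<Pi>\<^sub>E i\<in>I. N i) \<and> finite {i\<in>I. x i \<noteq> \<zero>\<^bsub>M\<^esub>}
          \<and> m = finsum M x {i\<in>I. x i \<noteq> \<zero>\<^bsub>M\<^esub>})"


section \<open>The category $\mathcal{O}$ and its subcategories $\mathcal{O}(\nu)$\<close>

definition fin_dim ::
    "'k::field \<Rightarrow> ('k free_gh set, 'm) module \<Rightarrow> 'm set \<Rightarrow> bool" where
  "fin_dim q M V \<longleftrightarrow>
    (\<exists>S. finite S \<and> S \<subseteq> V
       \<and> V = submodule_gen ((U_gh q)\<lparr>carrier := range (uscal q)\<rparr>) M S)"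

definition weight_space ::
    "'k::field \<Rightarrow> ('k free_gh set, 'm) module \<Rightarrow> 'k \<times> 'k \<times> 'k \<Rightarrow> 'm set" where
  "weight_space q M = (\<lambda>(a, b, c).
    {m \<in> carrier M. ugen q Gen_K \<odot>\<^bsub>M\<^esub> m = uscal q a \<odot>\<^bsub>M\<^esub> m
                  \<and> ugen q Gen_g \<odot>\<^bsub>M\<^esub> m = uscal q b \<odot>\<^bsub>M\<^esub> m
                  \<and> ugen q Gen_h \<odot>\<^bsub>M\<^esub> m = uscal q c \<odot>\<^bsub>M\<^esub> m})"

text \<open>
  Both categories are full subcategories of all left modules, so only their objects are
  recorded; morphisms are given by \<^const>\<open>left_module_hom\<close>.
\<close>

definition cat_O :: "'k::field \<Rightarrow> ('k free_gh set, 'm) module set" where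
  "cat_O q =
    {M. left_module (U_gh q) M
      \<and> finitely_generated (U_gh q) M
      \<and> is_direct_sum M UNIV (weight_space q M)
      \<and> (\<forall>w. fin_dim q M (weight_space q M w))
      \<and> (\<forall>m\<in>carrier M. fin_dim q M ((\<lambda>b. b \<odot>\<^bsub>M\<^esub> m) ` B_plus q))}"

definition cat_O_block ::
    "'k::field \<Rightarrow> ('k free_gh set \<Rightarrow> 'k) \<Rightarrow> ('k free_gh set, 'm) module set" where
  "cat_O_block q \<nu> =
    {M \<in> cat_O q. \<forall>m\<in>carrier M. \<forall>z\<in>Z_gh q. \<exists>n::nat.
       ((z \<ominus>\<^bsub>U_gh q\<^esub> uscal q (\<nu> z)) [^]\<^bsub>U_gh q\<^esub> n) \<odot>\<^bsub>M\<^esub> m = \<zero>\<^bsub>M\<^esub>}"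

end

theory Submission
  imports Defs
begin

text \<open>
  Everything rests on two facts: the algebra generated by \<open>C\<close> and all powers of \<open>g\<close> and \<open>h\<close> is
  central (\<open>Z_gh_central\<close>), and category O provides finite-dimensional weight spaces. A central
  element commutes with \<open>K\<close>, \<open>g\<close> and \<open>h\<close>, so \<open>C\<close> preserves each weight space; there \<open>g\<close> and \<open>h\<close>
  are scalars, and \<open>C\<close> satisfies a nonzero polynomial. Over an algebraically closed field every
  weight vector is therefore a sum of generalized eigenvectors of \<open>C\<close>.

  On a simultaneous eigenspace of \<open>g\<close> and \<open>h\<close> each central element acts as a polynomial in \<open>C\<close>
  (\<open>Z_gh_acts_by_casimir_polynomial\<close>). A genuine eigenvector of \<open>C\<close> in it thus defines a central
  character \<open>\<nu>\<close>, and a generalized eigenvector with the same eigenvalue lies in the primary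
  component of \<open>\<nu>\<close>, where each \<open>z - \<nu> z\<close> is locally nilpotent
  (\<open>generalized_eigenvector_in_primary_component\<close>). Hence every \<open>M\<close> in category O is the sum of its
  primary components (\<open>cat_O_primary_sum\<close>). The sum is direct because two central characters
  differ on some \<open>z\<close>, and a vector cannot be a generalized eigenvector of \<open>z\<close> for two different
  eigenvalues; the same remark shows that homomorphisms between different blocks vanish.
  Only finitely many components are nonzero, since finitely many generators have only finitely
  many components altogether.

  It remains to compare membership in category O of \<open>M\<close> and of its summands. Both directions are
  instances of one closure property: a module that is a finite sum of homomorphic images of
  objects of category O is again in category O (\<open>cat_O_sum_of_hom_images\<close>). A primary component is
  the image of \<open>M\<close> under the projection along the other components, and \<open>M\<close> is the sum of the
  images of the inclusions of its summands.
\<close>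

section \<open>Left modules: submodules, homomorphisms, spans\<close>

context left_module
begin

lemma smult_r_zero: "a \<in> carrier R \<Longrightarrow> a \<odot>\<^bsub>M\<^esub> \<zero>\<^bsub>M\<^esub> = \<zero>\<^bsub>M\<^esub>"
  using smult_r_distr[of a "\<zero>\<^bsub>M\<^esub>" "\<zero>\<^bsub>M\<^esub>"] smult_closed[of a "\<zero>\<^bsub>M\<^esub>"] by simp

lemma smult_l_zero: "x \<in> carrier M \<Longrightarrow> \<zero>\<^bsub>R\<^esub> \<odot>\<^bsub>M\<^esub> x = \<zero>\<^bsub>M\<^esub>"
  using smult_l_distr[of "\<zero>\<^bsub>R\<^esub>" "\<zero>\<^bsub>R\<^esub>" x] smult_closed[of "\<zero>\<^bsub>R\<^esub>" x] by simp

lemma smult_l_minus: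
  assumes "a \<in> carrier R" "x \<in> carrier M"
  shows "(\<ominus>\<^bsub>R\<^esub> a) \<odot>\<^bsub>M\<^esub> x = \<ominus>\<^bsub>M\<^esub> (a \<odot>\<^bsub>M\<^esub> x)"
proof -
  have "(\<ominus>\<^bsub>R\<^esub> a) \<odot>\<^bsub>M\<^esub> x \<oplus>\<^bsub>M\<^esub> a \<odot>\<^bsub>M\<^esub> x = \<zero>\<^bsub>M\<^esub>"
    using smult_l_distr[of "\<ominus>\<^bsub>R\<^esub> a" a x] assms by (simp add: R.l_neg smult_l_zero)
  then show ?thesis
    using assms M.minus_equality smult_closed by (metis R.a_inv_closed)
qed

lemma smult_l_diff:
  assumes "a \<in> carrier R" "b \<in> carrier R" "x \<in> carrier M"
  shows "(a \<ominus>\<^bsub>R\<^esub> b) \<odot>\<^bsub>M\<^esub> x = a \<odot>\<^bsub>M\<^esub> x \<ominus>\<^bsub>M\<^esub> b \<odot>\<^bsub>M\<^esub> x"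
  using assms by (simp add: R.minus_eq M.minus_eq smult_l_distr smult_l_minus)

lemma submodule_iff:
  "submodule H R M \<longleftrightarrow> H \<subseteq> carrier M \<and> \<zero>\<^bsub>M\<^esub> \<in> H
     \<and> (\<forall>x\<in>H. \<forall>y\<in>H. x \<oplus>\<^bsub>M\<^esub> y \<in> H) \<and> (\<forall>a\<in>carrier R. \<forall>x\<in>H. a \<odot>\<^bsub>M\<^esub> x \<in> H)"
    (is "_ \<longleftrightarrow> ?rhs")
proof
  assume H: "submodule H R M"
  interpret H: submodule H R M by (rule H)
  show ?rhs using H.subset H.one_closed H.m_closed by auto
next
  assume H: ?rhs
  have "\<ominus>\<^bsub>M\<^esub> x \<in> H" if "x \<in> H" for x
  proof -
    have "(\<ominus>\<^bsub>R\<^esub> \<one>\<^bsub>R\<^esub>) \<odot>\<^bsub>M\<^esub> x = \<ominus>\<^bsub>M\<^esub> x"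
      using that H smult_l_minus[of "\<one>\<^bsub>R\<^esub>" x] smult_one by auto
    then show ?thesis using H that by (metis R.a_inv_closed R.one_closed)
  qed
  then have "subgroup H (add_monoid M)"
    using H by (intro M.add.subgroupI) (auto simp: a_inv_def)
  then show "submodule H R M"
    using H by (intro submodule.intro) (auto simp: submodule_axioms_def)
qed

lemma submodule_minus: "submodule H R M \<Longrightarrow> x \<in> H \<Longrightarrow> \<ominus>\<^bsub>M\<^esub> x \<in> H"
  using subgroup.m_inv_closed[OF submodule.axioms(1)] by (fastforce simp: a_inv_def)

lemma submodule_diff:
  "submodule H R M \<Longrightarrow> x \<in> H \<Longrightarrow> y \<in> H \<Longrightarrow> x \<ominus>\<^bsub>M\<^esub> y \<in> H"
  using submodule_minus[of H y] submodule_iff[of H] by (simp add: M.minus_eq)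

lemma submodule_additive: "submodule H R M \<Longrightarrow> additive_subgroup H M"
  using submodule.axioms(1) by (simp add: additive_subgroup_def)

lemma submodule_gen_submodule:
  assumes "S \<subseteq> carrier M"
  shows "submodule (submodule_gen R M S) R M"
proof -
  have "submodule (carrier M) R M" by (simp add: submodule_iff smult_closed)
  then show ?thesis
    using assms unfolding submodule_gen_def submodule_iff
    by (intro conjI ballI subsetI InterI) (auto simp: submodule_iff)
qed

lemma submodule_gen_least:
  "submodule H R M \<Longrightarrow> S \<subseteq> H \<Longrightarrow> submodule_gen R M S \<subseteq> H"
  by (auto simp: submodule_gen_def)

lemma submodule_gen_incl: "S \<subseteq> submodule_gen R M S"
  by (auto simp: submodule_gen_def)

lemma submodule_gen_mono: "S \<subseteq> T \<Longrightarrow> submodule_gen R M S \<subseteq> submodule_gen R M T"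
  by (auto simp: submodule_gen_def)

lemma submodule_gen_eqI:
  "submodule H R M \<Longrightarrow> S \<subseteq> H \<Longrightarrow> H \<subseteq> submodule_gen R M S \<Longrightarrow> H = submodule_gen R M S"
  using submodule_gen_least by blast

lemma submodule_Int: "submodule H R M \<Longrightarrow> submodule H' R M \<Longrightarrow> submodule (H \<inter> H') R M"
  by (auto simp: submodule_iff)

lemma submodule_left_module:
  assumes "submodule H R M"
  shows "left_module R (M\<lparr>carrier := H\<rparr>)"
proof -
  have H: "H \<subseteq> carrier M" "\<zero>\<^bsub>M\<^esub> \<in> H" "\<And>x y. x \<in> H \<Longrightarrow> y \<in> H \<Longrightarrow> x \<oplus>\<^bsub>M\<^esub> y \<in> H"
     "\<And>a x. a \<in> carrier R \<Longrightarrow> x \<in> H \<Longrightarrow> a \<odot>\<^bsub>M\<^esub> x \<in> H"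
    using assms by (auto simp: submodule_iff)
  have "abelian_group (M\<lparr>carrier := H\<rparr>)"
  proof (rule abelian_groupI)
    fix x assume "x \<in> carrier (M\<lparr>carrier := H\<rparr>)"
    then show "\<exists>y\<in>carrier (M\<lparr>carrier := H\<rparr>). y \<oplus>\<^bsub>M\<lparr>carrier := H\<rparr>\<^esub> x = \<zero>\<^bsub>M\<lparr>carrier := H\<rparr>\<^esub>"
      using submodule_minus[OF assms, of x] H(1)
      by (auto intro!: bexI[of _ "\<ominus>\<^bsub>M\<^esub> x"] simp: M.l_neg subset_iff)
  qed (use H in \<open>auto simp: M.a_ac subset_iff\<close>)
  then show ?thesis
    using H R.ring_axioms
    by (auto intro!: left_module.intro left_module_axioms.intro
        simp: smult_l_distr smult_r_distr smult_assoc smult_one subset_iff)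
qed

lemma left_module_subring:
  assumes "subring S R"
  shows "left_module (R\<lparr>carrier := S\<rparr>) M"
proof -
  interpret S: subring S R by (rule assms)
  have "ring (R\<lparr>carrier := S\<rparr>)"
    using R.subring_is_ring[OF assms] .
  then show ?thesis
    using S.subset M.abelian_group_axioms
    by (auto intro!: left_module.intro left_module_axioms.intro
        simp: smult_l_distr smult_r_distr smult_assoc smult_one smult_closed subset_iff)
qed

end

context
  fixes R :: "('r, 'c) ring_scheme" and M :: "('r, 'm) module" and N :: "('r, 'n) module"
    and f :: "'m \<Rightarrow> 'n"
  assumes M: "left_module R M" and N: "left_module R N" and f: "f \<in> left_module_hom R M N"
begin

interpretation M: left_module R M by (rule M)
interpretation N: left_module R N by (rule N)

lemma left_module_hom_closed: "x \<in> carrier M \<Longrightarrow> f x \<in> carrier N"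
  and left_module_hom_add:
    "x \<in> carrier M \<Longrightarrow> y \<in> carrier M \<Longrightarrow> f (x \<oplus>\<^bsub>M\<^esub> y) = f x \<oplus>\<^bsub>N\<^esub> f y"
  and left_module_hom_smult:
    "a \<in> carrier R \<Longrightarrow> x \<in> carrier M \<Longrightarrow> f (a \<odot>\<^bsub>M\<^esub> x) = a \<odot>\<^bsub>N\<^esub> f x"
  using f by (auto simp: left_module_hom_def)

lemma left_module_hom_zero: "f \<zero>\<^bsub>M\<^esub> = \<zero>\<^bsub>N\<^esub>"
  using left_module_hom_add[of "\<zero>\<^bsub>M\<^esub>" "\<zero>\<^bsub>M\<^esub>"] left_module_hom_closed[of "\<zero>\<^bsub>M\<^esub>"] by simp

lemma left_module_hom_submodule_gen:
  assumes "S \<subseteq> carrier M"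
  shows "f ` submodule_gen R M S \<subseteq> submodule_gen R N (f ` S)"
proof -
  let ?T = "submodule_gen R N (f ` S)"
  have T: "submodule ?T R N"
    using assms left_module_hom_closed by (intro N.submodule_gen_submodule) auto
  have "submodule {x \<in> carrier M. f x \<in> ?T} R M"
    using T left_module_hom_add left_module_hom_smult left_module_hom_zero
    by (auto simp: M.submodule_iff N.submodule_iff M.smult_closed)
  then have "submodule_gen R M S \<subseteq> {x \<in> carrier M. f x \<in> ?T}"
    using assms N.submodule_gen_incl[of "f ` S"] by (intro M.submodule_gen_least) auto
  then show ?thesis by auto
qed

end

lemma left_module_hom_subring:
  assumes "subring S R" "f \<in> left_module_hom R M N"
  shows "f \<in> left_module_hom (R\<lparr>carrier := S\<rparr>) M N"
  using assms(2) subringE(1)[OF assms(1)] by (auto simp: left_module_hom_def subset_iff)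

lemma submodule_inclusion_hom:
  assumes "H \<subseteq> carrier M"
  shows "(\<lambda>x. x) \<in> left_module_hom R (M\<lparr>carrier := H\<rparr>) M"
  using assms by (auto simp: left_module_hom_def)

text \<open>
  The usual argument: once a vector \<open>v = c s + u\<close> with \<open>c \<noteq> 0\<close> exists in the
  subspace, the spanning vector \<open>s\<close> can be exchanged for \<open>v\<close>, and subtracting multiples
  of \<open>v\<close> moves any vector of the subspace into the span of the remaining generators.
\<close>

lemma (in left_module) division_ring_submodule_finitely_generated:
  assumes div: "\<And>c. c \<in> carrier R \<Longrightarrow> c \<noteq> \<zero>\<^bsub>R\<^esub> \<Longrightarrow> \<exists>d\<in>carrier R. d \<otimes>\<^bsub>R\<^esub> c = \<one>\<^bsub>R\<^esub>"
    and "finite S" "S \<subseteq> carrier M" "submodule V R M" "V \<subseteq> submodule_gen R M S"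
  shows "\<exists>T. finite T \<and> T \<subseteq> V \<and> V = submodule_gen R M T"
  using assms(2-5)
proof (induction S arbitrary: V rule: finite_induct)
  case empty
  have "submodule {\<zero>\<^bsub>M\<^esub>} R M" by (simp add: submodule_iff smult_r_zero)
  then have "V \<subseteq> {\<zero>\<^bsub>M\<^esub>}"
    using empty.prems(3) submodule_gen_least[of "{\<zero>\<^bsub>M\<^esub>}" "{}"] by blast
  moreover have "submodule {\<zero>\<^bsub>M\<^esub>} R M \<Longrightarrow> \<zero>\<^bsub>M\<^esub> \<in> V" using empty.prems(2) by (simp add: submodule_iff)
  ultimately have "V = {\<zero>\<^bsub>M\<^esub>}" using \<open>submodule {\<zero>\<^bsub>M\<^esub>} R M\<close> by blast
  have "V = submodule_gen R M {}"
    using submodule_gen_submodule[of "{}"] \<open>V = _\<close> empty.prems(2)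
    by (intro submodule_gen_eqI) (auto simp: submodule_iff)
  then show ?case by blast
next
  case (insert s S)
  let ?P = "submodule_gen R M S"
  have s: "s \<in> carrier M" and S: "S \<subseteq> carrier M" using insert.prems(1) by auto
  have P: "submodule ?P R M" using submodule_gen_submodule[OF S] .
  have P_carr: "?P \<subseteq> carrier M" and V_carr: "V \<subseteq> carrier M"
    using P insert.prems(2) by (auto simp: submodule_iff)
  obtain T where T: "finite T" "T \<subseteq> V \<inter> ?P" "V \<inter> ?P = submodule_gen R M T"
    using insert.IH[OF S submodule_Int[OF insert.prems(2) P]] by blast
  show ?case
  proof (cases "V \<subseteq> ?P")
    case True
    then have "V \<inter> ?P = V" by auto
    with T show ?thesis by auto
  next
    case False
    have decomp: "\<exists>c\<in>carrier R. \<exists>u\<in>?P. w = c \<odot>\<^bsub>M\<^esub> s \<oplus>\<^bsub>M\<^esub> u" if "w \<in> V" for w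
    proof -
      let ?Q = "{w. \<exists>c\<in>carrier R. \<exists>u\<in>?P. w = c \<odot>\<^bsub>M\<^esub> s \<oplus>\<^bsub>M\<^esub> u}"
      have "submodule ?Q R M"
        unfolding submodule_iff
      proof (intro conjI ballI)
        show "?Q \<subseteq> carrier M" using P_carr s by (auto simp: smult_closed)
        show "\<zero>\<^bsub>M\<^esub> \<in> ?Q" using P s
          by (auto intro!: bexI[of _ "\<zero>\<^bsub>R\<^esub>"] bexI[of _ "\<zero>\<^bsub>M\<^esub>"] simp: submodule_iff smult_l_zero)
      next
        fix x y assume "x \<in> ?Q" "y \<in> ?Q"
        then obtain c u d v where *: "c \<in> carrier R" "u \<in> ?P" "x = c \<odot>\<^bsub>M\<^esub> s \<oplus>\<^bsub>M\<^esub> u"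
          "d \<in> carrier R" "v \<in> ?P" "y = d \<odot>\<^bsub>M\<^esub> s \<oplus>\<^bsub>M\<^esub> v" by blast
        have uv: "u \<in> carrier M" "v \<in> carrier M" using * P_carr by auto
        have "x \<oplus>\<^bsub>M\<^esub> y = (c \<oplus>\<^bsub>R\<^esub> d) \<odot>\<^bsub>M\<^esub> s \<oplus>\<^bsub>M\<^esub> (u \<oplus>\<^bsub>M\<^esub> v)"
          using * uv s by (simp add: smult_l_distr M.a_ac smult_closed)
        moreover have "u \<oplus>\<^bsub>M\<^esub> v \<in> ?P" using P * by (simp add: submodule_iff)
        ultimately show "x \<oplus>\<^bsub>M\<^esub> y \<in> ?Q" using * by blast
      next
        fix a x assume "a \<in> carrier R" "x \<in> ?Q"
        then obtain c u where *: "c \<in> carrier R" "u \<in> ?P" "x = c \<odot>\<^bsub>M\<^esub> s \<oplus>\<^bsub>M\<^esub> u" by blast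
        have "a \<odot>\<^bsub>M\<^esub> x = (a \<otimes>\<^bsub>R\<^esub> c) \<odot>\<^bsub>M\<^esub> s \<oplus>\<^bsub>M\<^esub> a \<odot>\<^bsub>M\<^esub> u"
          using * P_carr s \<open>a \<in> carrier R\<close> by (auto simp: smult_r_distr smult_assoc smult_closed)
        moreover have "a \<odot>\<^bsub>M\<^esub> u \<in> ?P" using P * \<open>a \<in> carrier R\<close> by (simp add: submodule_iff)
        ultimately show "a \<odot>\<^bsub>M\<^esub> x \<in> ?Q" using * \<open>a \<in> carrier R\<close> by blast
      qed
      moreover have "insert s S \<subseteq> ?Q"
      proof -
        have "s = \<one>\<^bsub>R\<^esub> \<odot>\<^bsub>M\<^esub> s \<oplus>\<^bsub>M\<^esub> \<zero>\<^bsub>M\<^esub>" using s by (simp add: smult_one)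
        moreover have "\<zero>\<^bsub>M\<^esub> \<in> ?P" using P by (simp add: submodule_iff)
        ultimately have "s \<in> ?Q" using R.one_closed by blast
        moreover have "t \<in> ?Q" if "t \<in> S" for t
        proof -
          have "t = \<zero>\<^bsub>R\<^esub> \<odot>\<^bsub>M\<^esub> s \<oplus>\<^bsub>M\<^esub> t" using s S that by (auto simp: smult_l_zero)
          moreover have "t \<in> ?P" using that submodule_gen_incl by blast
          ultimately show ?thesis using R.zero_closed by blast
        qed
        ultimately show ?thesis by auto
      qed
      ultimately have "submodule_gen R M (insert s S) \<subseteq> ?Q" by (rule submodule_gen_least)
      then show ?thesis using that insert.prems(3) by blast
    qed
    obtain v where v: "v \<in> V" "v \<notin> ?P" using False by blast
    obtain c u where cu: "c \<in> carrier R" "u \<in> ?P" "v = c \<odot>\<^bsub>M\<^esub> s \<oplus>\<^bsub>M\<^esub> u"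
      using decomp[OF v(1)] by blast
    have "c \<noteq> \<zero>\<^bsub>R\<^esub>" using v(2) cu s P_carr by (auto simp: smult_l_zero)
    then obtain d where d: "d \<in> carrier R" "d \<otimes>\<^bsub>R\<^esub> c = \<one>\<^bsub>R\<^esub>" using div cu(1) by blast
    have vT: "insert v T \<subseteq> carrier M" using v T V_carr by auto
    let ?G = "submodule_gen R M (insert v T)"
    have G: "submodule ?G R M" using submodule_gen_submodule[OF vT] .
    have "w \<in> ?G" if w: "w \<in> V" for w
    proof -
      obtain e u' where eu: "e \<in> carrier R" "u' \<in> ?P" "w = e \<odot>\<^bsub>M\<^esub> s \<oplus>\<^bsub>M\<^esub> u'"
        using decomp[OF w] by blast
      let ?b = "e \<otimes>\<^bsub>R\<^esub> d"
      have b: "?b \<in> carrier R" using eu d by simp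
      have u_carr: "u \<in> carrier M" "u' \<in> carrier M" "v \<in> carrier M" "w \<in> carrier M"
        using cu eu P_carr V_carr v w by auto
      have "?b \<odot>\<^bsub>M\<^esub> v = (e \<otimes>\<^bsub>R\<^esub> (d \<otimes>\<^bsub>R\<^esub> c)) \<odot>\<^bsub>M\<^esub> s \<oplus>\<^bsub>M\<^esub> ?b \<odot>\<^bsub>M\<^esub> u"
        using cu eu d s u_carr b
        by (simp add: smult_r_distr smult_closed smult_assoc[symmetric] R.m_assoc)
      also have "\<dots> = e \<odot>\<^bsub>M\<^esub> s \<oplus>\<^bsub>M\<^esub> ?b \<odot>\<^bsub>M\<^esub> u" using d eu by simp
      finally have bv: "?b \<odot>\<^bsub>M\<^esub> v = e \<odot>\<^bsub>M\<^esub> s \<oplus>\<^bsub>M\<^esub> ?b \<odot>\<^bsub>M\<^esub> u" .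
      have es: "e \<odot>\<^bsub>M\<^esub> s \<in> carrier M" "?b \<odot>\<^bsub>M\<^esub> u \<in> carrier M" "?b \<odot>\<^bsub>M\<^esub> v \<in> carrier M"
        using eu s b u_carr smult_closed by auto
      have "w \<ominus>\<^bsub>M\<^esub> ?b \<odot>\<^bsub>M\<^esub> v = u' \<ominus>\<^bsub>M\<^esub> ?b \<odot>\<^bsub>M\<^esub> u"
        using es u_carr unfolding bv eu(3) M.minus_eq
        by (simp add: M.minus_add M.a_ac M.r_neg1 M.r_neg2)
      also have "\<dots> \<in> ?P" using P eu cu b submodule_diff by (simp add: submodule_iff)
      finally have "w \<ominus>\<^bsub>M\<^esub> ?b \<odot>\<^bsub>M\<^esub> v \<in> V \<inter> ?P"
        using submodule_diff[OF insert.prems(2) w] insert.prems(2) v(1) b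
        by (simp add: submodule_iff)
      then have "w \<ominus>\<^bsub>M\<^esub> ?b \<odot>\<^bsub>M\<^esub> v \<in> ?G"
        using T(3) submodule_gen_mono[of T "insert v T"] by blast
      moreover have "?b \<odot>\<^bsub>M\<^esub> v \<in> ?G"
        using submodule_gen_incl[of "insert v T"] G b by (auto simp: submodule_iff)
      ultimately have "(w \<ominus>\<^bsub>M\<^esub> ?b \<odot>\<^bsub>M\<^esub> v) \<oplus>\<^bsub>M\<^esub> ?b \<odot>\<^bsub>M\<^esub> v \<in> ?G"
        using G by (simp add: submodule_iff)
      then show ?thesis
        using es u_carr by (simp add: M.minus_eq M.a_assoc M.l_neg)
    qed
    moreover have "insert v T \<subseteq> V" using v T by auto
    ultimately have "V = ?G" using insert.prems(2) by (intro submodule_gen_eqI) auto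
    then show ?thesis using T(1) \<open>insert v T \<subseteq> V\<close> by blast
  qed
qed

text \<open>
  The summands are submodules, so taking the \<open>A\<close>-part of a vector is linear over \<open>R\<close>.
\<close>

lemma (in left_module) projection_along_complement:
  assumes A: "submodule A R M" and B: "submodule B R M"
    and gen: "\<And>m. m \<in> carrier M \<Longrightarrow> \<exists>a\<in>A. \<exists>b\<in>B. m = a \<oplus>\<^bsub>M\<^esub> b" and disj: "A \<inter> B \<subseteq> {\<zero>\<^bsub>M\<^esub>}"
  obtains p where "p \<in> left_module_hom R M (M\<lparr>carrier := A\<rparr>)" "\<And>a. a \<in> A \<Longrightarrow> p a = a"
proof -
  have AB: "A \<subseteq> carrier M" "B \<subseteq> carrier M" "\<zero>\<^bsub>M\<^esub> \<in> B" using A B by (auto simp: submodule_iff)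
  define p where "p m = (THE a. a \<in> A \<and> (\<exists>b\<in>B. m = a \<oplus>\<^bsub>M\<^esub> b))" for m
  have p: "p (a \<oplus>\<^bsub>M\<^esub> b) = a" if ab: "a \<in> A" "b \<in> B" for a b
    unfolding p_def
  proof (rule the_equality)
    fix a' assume "a' \<in> A \<and> (\<exists>b'\<in>B. a \<oplus>\<^bsub>M\<^esub> b = a' \<oplus>\<^bsub>M\<^esub> b')"
    then obtain b' where a': "a' \<in> A" "b' \<in> B" "a \<oplus>\<^bsub>M\<^esub> b = a' \<oplus>\<^bsub>M\<^esub> b'" by blast
    have carr: "a \<in> carrier M" "b \<in> carrier M" "a' \<in> carrier M" "b' \<in> carrier M"
      using ab a' AB by auto
    have "a' \<ominus>\<^bsub>M\<^esub> a = (a' \<oplus>\<^bsub>M\<^esub> b') \<oplus>\<^bsub>M\<^esub> (\<ominus>\<^bsub>M\<^esub> b' \<oplus>\<^bsub>M\<^esub> \<ominus>\<^bsub>M\<^esub> a)"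
      using carr by (simp add: M.minus_eq M.a_assoc M.r_neg2 M.r_neg1)
    also have "\<dots> = b \<ominus>\<^bsub>M\<^esub> b'"
      unfolding a'(3)[symmetric] M.minus_eq M.a_comm[OF carr(1,2)] using carr
      by (simp add: M.a_assoc M.a_comm[of "\<ominus>\<^bsub>M\<^esub> b'"] M.r_neg2)
    finally have "a' \<ominus>\<^bsub>M\<^esub> a \<in> A \<inter> B"
      using submodule_diff[OF A a'(1) ab(1)] submodule_diff[OF B ab(2) a'(2)] by simp
    then have "a' \<ominus>\<^bsub>M\<^esub> a = \<zero>\<^bsub>M\<^esub>" using disj by blast
    then have "a' = \<zero>\<^bsub>M\<^esub> \<oplus>\<^bsub>M\<^esub> a"
      using carr by (metis M.minus_eq M.a_assoc M.a_inv_closed M.l_neg M.r_zero)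
    then show "a' = a" using carr by simp
  qed (use ab in blast)
  show ?thesis
  proof (rule that)
    show "p \<in> left_module_hom R M (M\<lparr>carrier := A\<rparr>)"
      unfolding left_module_hom_def
    proof (intro CollectI conjI ballI)
      show "p \<in> carrier M \<rightarrow> carrier (M\<lparr>carrier := A\<rparr>)"
      proof
        fix m assume "m \<in> carrier M"
        then obtain a b where "a \<in> A" "b \<in> B" "m = a \<oplus>\<^bsub>M\<^esub> b" using gen by blast
        then show "p m \<in> carrier (M\<lparr>carrier := A\<rparr>)" using p by simp
      qed
    next
      fix x y assume "x \<in> carrier M" "y \<in> carrier M"
      obtain a b where ab: "a \<in> A" "b \<in> B" "x = a \<oplus>\<^bsub>M\<^esub> b" using gen[OF \<open>x \<in> _\<close>] by blast
      obtain a' b' where ab': "a' \<in> A" "b' \<in> B" "y = a' \<oplus>\<^bsub>M\<^esub> b'"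
        using gen[OF \<open>y \<in> _\<close>] by blast
      note * = ab(1,2) ab'(1,2) ab(3) ab'(3)
      have "x \<oplus>\<^bsub>M\<^esub> y = (a \<oplus>\<^bsub>M\<^esub> a') \<oplus>\<^bsub>M\<^esub> (b \<oplus>\<^bsub>M\<^esub> b')"
      proof -
        have "a \<in> carrier M" "b \<in> carrier M" "a' \<in> carrier M" "b' \<in> carrier M"
          using * AB by auto
        then show ?thesis unfolding *(5,6) by (simp add: M.a_ac)
      qed
      moreover have "a \<oplus>\<^bsub>M\<^esub> a' \<in> A" "b \<oplus>\<^bsub>M\<^esub> b' \<in> B"
        using *(1-4) A B by (simp_all add: submodule_iff)
      ultimately show "p (x \<oplus>\<^bsub>M\<^esub> y) = p x \<oplus>\<^bsub>M\<lparr>carrier := A\<rparr>\<^esub> p y"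
        using p[OF *(1,2)] p[OF *(3,4)] p *(5,6) by simp
    next
      fix c x assume c: "c \<in> carrier R" and "x \<in> carrier M"
      then obtain a b where *: "a \<in> A" "b \<in> B" "x = a \<oplus>\<^bsub>M\<^esub> b" using gen by blast
      have "c \<odot>\<^bsub>M\<^esub> x = c \<odot>\<^bsub>M\<^esub> a \<oplus>\<^bsub>M\<^esub> c \<odot>\<^bsub>M\<^esub> b" using * AB c smult_r_distr by blast
      moreover have "c \<odot>\<^bsub>M\<^esub> a \<in> A" "c \<odot>\<^bsub>M\<^esub> b \<in> B" using *(1,2) A B c by (simp_all add: submodule_iff)
      ultimately show "p (c \<odot>\<^bsub>M\<^esub> x) = c \<odot>\<^bsub>M\<lparr>carrier := A\<rparr>\<^esub> p x" using p * by simp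
    qed
    show "p a = a" if "a \<in> A" for a using p[OF that AB(3)] AB that by auto
  qed
qed

section \<open>Sums of subgroups\<close>

text \<open>
  The subgroup generated by the \<open>N i\<close>, built by adding one element at a time: membership can
  then be used by induction, without handling finitely supported families. The link to
  \<open>finsum\<close> is made once, for the internal direct sums below.
\<close>

inductive_set subgroup_sum ::
    "('m, 'c) ring_scheme \<Rightarrow> 'i set \<Rightarrow> ('i \<Rightarrow> 'm set) \<Rightarrow> 'm set"
  for M I N where
  zero: "\<zero>\<^bsub>M\<^esub> \<in> subgroup_sum M I N"
| add: "i \<in> I \<Longrightarrow> n \<in> N i \<Longrightarrow> m \<in> subgroup_sum M I N \<Longrightarrow> n \<oplus>\<^bsub>M\<^esub> m \<in> subgroup_sum M I N"

context abelian_group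
begin

lemma additive_subgroupD:
  assumes "additive_subgroup H G"
  shows "H \<subseteq> carrier G" "\<zero> \<in> H" "x \<in> H \<Longrightarrow> y \<in> H \<Longrightarrow> x \<oplus> y \<in> H" "x \<in> H \<Longrightarrow> \<ominus> x \<in> H"
    "x \<in> H \<Longrightarrow> y \<in> H \<Longrightarrow> x \<ominus> y \<in> H"
proof -
  interpret H: additive_subgroup H G by fact
  show "H \<subseteq> carrier G" using H.a_Hcarr by blast
  show "\<zero> \<in> H" by (rule H.zero_closed)
  show "x \<in> H \<Longrightarrow> y \<in> H \<Longrightarrow> x \<oplus> y \<in> H" by (rule H.a_closed)
  show minus: "\<ominus> x \<in> H" if "x \<in> H" for x
    using subgroup.m_inv_closed[OF H.a_subgroup that] by (simp add: a_inv_def)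
  show "x \<ominus> y \<in> H" if "x \<in> H" "y \<in> H"
    using H.a_closed[OF that(1) minus[OF that(2)]] by (simp add: minus_eq)
qed

lemma subgroup_sum_closed:
  assumes "\<And>i. i \<in> I \<Longrightarrow> N i \<subseteq> carrier G" "m \<in> subgroup_sum G I N"
  shows "m \<in> carrier G"
  using assms(2) by induction (use assms(1) in auto)

lemma subgroup_sum_add:
  assumes N: "\<And>i. i \<in> I \<Longrightarrow> N i \<subseteq> carrier G"
    and "m \<in> subgroup_sum G I N" "m' \<in> subgroup_sum G I N"
  shows "m \<oplus> m' \<in> subgroup_sum G I N"
  using assms(2)
proof induction
  case zero
  then show ?case using subgroup_sum_closed[OF N assms(3)] assms(3) by simp
next
  case (add i n m)
  have "n \<in> carrier G" "m \<in> carrier G" "m' \<in> carrier G"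
    using add N subgroup_sum_closed[OF N] assms(3) by auto
  then have "n \<oplus> m \<oplus> m' = n \<oplus> (m \<oplus> m')" by (simp add: a_assoc)
  then show ?case using add by (simp add: subgroup_sum.add)
qed

lemma subgroup_sum_incl:
  assumes "N i \<subseteq> carrier G" "i \<in> I" "n \<in> N i"
  shows "n \<in> subgroup_sum G I N"
proof -
  have "n \<oplus> \<zero> \<in> subgroup_sum G I N" using assms by (intro subgroup_sum.intros)
  then show ?thesis using assms by (auto simp: subset_iff)
qed

lemma subgroup_sum_additive_subgroup:
  assumes N: "\<And>i. i \<in> I \<Longrightarrow> additive_subgroup (N i) G"
  shows "additive_subgroup (subgroup_sum G I N) G"
proof -
  have N': "\<And>i. i \<in> I \<Longrightarrow> N i \<subseteq> carrier G" using N additive_subgroupD(1) by blast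
  have minus: "\<ominus> m \<in> subgroup_sum G I N" if "m \<in> subgroup_sum G I N" for m
    using that
  proof induction
    case zero
    have "\<ominus> \<zero> = \<zero>" using minus_equality[of \<zero> \<zero>] by simp
    then show ?case using subgroup_sum.zero[of G I N] by metis
  next
    case (add i n m)
    have "n \<in> carrier G" "m \<in> carrier G"
      using add N' subgroup_sum_closed[OF N'] by auto
    then have "\<ominus> (n \<oplus> m) = \<ominus> n \<oplus> \<ominus> m" by (simp add: minus_add)
    then show ?case using add additive_subgroupD(4)[OF N] by (simp add: subgroup_sum.add)
  qed
  have "subgroup (subgroup_sum G I N) (add_monoid G)"
    using subgroup_sum_closed[OF N'] subgroup_sum.zero[of G I N] minus subgroup_sum_add[OF N']
    by (intro add.subgroupI) (auto simp: a_inv_def)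
  then show ?thesis by (simp add: additive_subgroup_def)
qed

lemma subgroup_sum_least:
  assumes "additive_subgroup H G" "\<And>i. i \<in> I \<Longrightarrow> N i \<subseteq> H"
  shows "subgroup_sum G I N \<subseteq> H"
proof
  fix m assume "m \<in> subgroup_sum G I N"
  then show "m \<in> H"
  proof induction
    case (add i n m)
    then show ?case using additive_subgroupD(3)[OF assms(1)] assms(2) by blast
  qed (rule additive_subgroupD(2)[OF assms(1)])
qed

lemma subgroup_sum_split:
  assumes N: "\<And>i. i \<in> I \<Longrightarrow> additive_subgroup (N i) G" and "i \<in> I" "m \<in> subgroup_sum G I N"
  obtains y r where "y \<in> N i" "r \<in> subgroup_sum G (I - {i}) N" "m = y \<oplus> r"
proof -
  have N': "\<And>i. i \<in> I \<Longrightarrow> N i \<subseteq> carrier G" using N additive_subgroupD(1) by blast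
  have "\<exists>y\<in>N i. \<exists>r\<in>subgroup_sum G (I - {i}) N. m = y \<oplus> r"
    using assms(3)
  proof induction
    case zero
    then show ?case
      using additive_subgroupD(2)[OF N[OF assms(2)]] subgroup_sum.zero[of G "I - {i}" N] l_zero[of \<zero>]
      by (metis zero_closed)
  next
    case (add j n m)
    then obtain y r where yr: "y \<in> N i" "r \<in> subgroup_sum G (I - {i}) N" "m = y \<oplus> r" by blast
    have carr: "y \<in> carrier G" "r \<in> carrier G" "n \<in> carrier G"
      using yr N' assms(2) add subgroup_sum_closed[of "I - {i}" N r] by auto
    show ?case
    proof (cases "j = i")
      case True
      have "n \<oplus> m = (n \<oplus> y) \<oplus> r" using yr carr by (simp add: a_assoc)
      moreover have "n \<oplus> y \<in> N i" using True add yr additive_subgroupD(3)[OF N[OF assms(2)]] by blast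
      ultimately show ?thesis using yr by blast
    next
      case False
      have "n \<oplus> m = y \<oplus> (n \<oplus> r)" using yr carr by (simp add: a_ac)
      moreover have "n \<oplus> r \<in> subgroup_sum G (I - {i}) N"
        using False add yr by (intro subgroup_sum.add[of j]) auto
      ultimately show ?thesis using yr by blast
    qed
  qed
  then show ?thesis using that by blast
qed

lemma finsum_in_subgroup_sum:
  assumes N: "\<And>i. i \<in> I \<Longrightarrow> N i \<subseteq> carrier G" and "finite S" "S \<subseteq> I" "\<And>i. i \<in> S \<Longrightarrow> x i \<in> N i"
  shows "finsum G x S \<in> subgroup_sum G I N"
  using assms(2-4)
proof (induction S rule: finite_induct)
  case empty
  then show ?case by (simp add: subgroup_sum.zero)
next
  case (insert i S)
  have "finsum G x (insert i S) = x i \<oplus> finsum G x S"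
    using insert N by (intro finsum_insert) auto
  then show ?case using insert by (auto intro!: subgroup_sum.add[of i])
qed

lemma subgroup_sum_finsum:
  assumes N: "\<And>i. i \<in> I \<Longrightarrow> additive_subgroup (N i) G" and "m \<in> subgroup_sum G I N"
  shows "\<exists>x. x \<in> (\<Pi>\<^sub>E i\<in>I. N i) \<and> finite {i\<in>I. x i \<noteq> \<zero>} \<and> m = finsum G x {i\<in>I. x i \<noteq> \<zero>}"
  using assms(2)
proof induction
  case zero
  have "{i \<in> I. (\<lambda>i\<in>I. \<zero>) i \<noteq> \<zero>} = {}" by auto
  then show ?case
    using additive_subgroupD(2)[OF N] by (intro exI[of _ "\<lambda>i\<in>I. \<zero>"]) auto
next
  case (add i n m)
  have N': "\<And>i. i \<in> I \<Longrightarrow> N i \<subseteq> carrier G" using N additive_subgroupD(1) by blast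
  obtain x where x: "x \<in> (\<Pi>\<^sub>E i\<in>I. N i)" "finite {i\<in>I. x i \<noteq> \<zero>}"
    "m = finsum G x {i\<in>I. x i \<noteq> \<zero>}" using add by blast
  have xN: "\<And>j. j \<in> I \<Longrightarrow> x j \<in> N j" "\<And>j. j \<in> I \<Longrightarrow> x j \<in> carrier G"
    using x(1) N' by auto
  \<comment> \<open>The index \<open>i\<close> may enter or leave the support, so both sums are taken over \<open>insert i S\<close>.\<close>
  define S where "S = {i\<in>I. x i \<noteq> \<zero>} - {i}"
  define y where "y = x(i := n \<oplus> x i)"
  have S: "finite S" "i \<notin> S" "S \<subseteq> I" using x(2) by (auto simp: S_def)
  have n: "n \<in> carrier G" using add N' by auto
  have yN: "y \<in> (\<Pi>\<^sub>E i\<in>I. N i)"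
    using x(1) add(1,2) xN(1)[of i] additive_subgroupD(3)[OF N[of i]]
    by (auto simp: y_def PiE_iff extensional_def)
  have yC: "\<And>j. j \<in> I \<Longrightarrow> y j \<in> carrier G" using yN N' by auto
  have *: "finsum G z {i\<in>I. z i \<noteq> \<zero>} = finsum G z (insert i S)"
    if "{i\<in>I. z i \<noteq> \<zero>} \<subseteq> insert i S" "\<And>j. j \<in> I \<Longrightarrow> z j \<in> carrier G" for z
    using that S add(1) by (intro add.finprod_mono_neutral_cong_left) auto
  have "m = x i \<oplus> finsum G x S"
    using x(3) *[of x] xN(2) S add(1) finsum_insert[of S i x] by (auto simp: S_def)
  then have "n \<oplus> m = (n \<oplus> x i) \<oplus> finsum G x S"
    using n xN(2) add(1) S by (subst a_assoc) (auto intro!: finsum_closed)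
  also have "finsum G x S = finsum G y S"
    using S xN(2) yC by (intro finsum_cong') (auto simp: y_def)
  also have "(n \<oplus> x i) \<oplus> \<dots> = finsum G y (insert i S)"
  proof -
    have "y i = n \<oplus> x i" by (simp add: y_def)
    moreover have "y \<in> S \<rightarrow> carrier G" using yC S by blast
    ultimately show ?thesis using S yC[OF add(1)] finsum_insert[of S i y] by simp
  qed
  also have "\<dots> = finsum G y {i\<in>I. y i \<noteq> \<zero>}"
  proof (rule *[symmetric])
    show "{j\<in>I. y j \<noteq> \<zero>} \<subseteq> insert i S" by (auto simp: y_def S_def)
  qed (rule yC)
  finally have "n \<oplus> m = finsum G y {i\<in>I. y i \<noteq> \<zero>}" .
  moreover have "finite {i\<in>I. y i \<noteq> \<zero>}"
    by (rule finite_subset[of _ "insert i S"]) (use S in \<open>auto simp: y_def S_def\<close>)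
  ultimately show ?case using yN by blast
qed

end

lemma (in abelian_group) subgroup_sum_mono:
  assumes "m \<in> subgroup_sum G I N" "I \<subseteq> J" "\<And>i. i \<in> I \<Longrightarrow> N i \<subseteq> N' i"
  shows "m \<in> subgroup_sum G J N'"
  using assms(1)
proof induction
  case (add i n m)
  then show ?case using assms(2,3) by (intro subgroup_sum.add[of i]) auto
qed (rule subgroup_sum.zero)

lemma subgroup_sum_finite:
  assumes "m \<in> subgroup_sum M I N"
  shows "\<exists>T. finite T \<and> T \<subseteq> I \<and> m \<in> subgroup_sum M T N"
  using assms
proof induction
  case zero
  then show ?case using subgroup_sum.zero[of M "{}" N] by blast
next
  case (add i n m)
  then obtain T where T: "finite T" "T \<subseteq> I" "m \<in> subgroup_sum M T N" by blast
  have "m \<in> subgroup_sum M (insert i T) N"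
    using T(3) by induction (auto intro: subgroup_sum.intros)
  then have "n \<oplus>\<^bsub>M\<^esub> m \<in> subgroup_sum M (insert i T) N"
    using add(2) by (intro subgroup_sum.add[of i]) auto
  then show ?case using T add(1) by (intro exI[of _ "insert i T"]) auto
qed

text \<open>
  Uniqueness of the components: the difference of two candidates for the \<open>i\<close>-th component lies
  both in \<open>N i\<close> and in the sum of the other subgroups.
\<close>

lemma is_direct_sumI:
  assumes "abelian_group M"
    and N: "\<And>i. i \<in> I \<Longrightarrow> additive_subgroup (N i) M"
    and gen: "carrier M \<subseteq> subgroup_sum M I N"
    and indep: "\<And>i y. i \<in> I \<Longrightarrow> y \<in> N i \<Longrightarrow> y \<in> subgroup_sum M (I - {i}) N \<Longrightarrow> y = \<zero>\<^bsub>M\<^esub>"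
  shows "is_direct_sum M I N"
  unfolding is_direct_sum_def
proof (intro conjI ballI ex_ex1I)
  interpret abelian_group M by fact
  show "\<And>i. i \<in> I \<Longrightarrow> additive_subgroup (N i) M" using N .
  fix m assume m: "m \<in> carrier M"
  show "\<exists>x. x \<in> (\<Pi>\<^sub>E i\<in>I. N i) \<and> finite {i\<in>I. x i \<noteq> \<zero>\<^bsub>M\<^esub>}
          \<and> m = finsum M x {i\<in>I. x i \<noteq> \<zero>\<^bsub>M\<^esub>}"
    by (rule subgroup_sum_finsum) (use N gen m in auto)
next
  interpret abelian_group M by fact
  fix m x y
  assume x: "x \<in> (\<Pi>\<^sub>E i\<in>I. N i) \<and> finite {i\<in>I. x i \<noteq> \<zero>\<^bsub>M\<^esub>} \<and> m = finsum M x {i\<in>I. x i \<noteq> \<zero>\<^bsub>M\<^esub>}"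
    and y: "y \<in> (\<Pi>\<^sub>E i\<in>I. N i) \<and> finite {i\<in>I. y i \<noteq> \<zero>\<^bsub>M\<^esub>} \<and> m = finsum M y {i\<in>I. y i \<noteq> \<zero>\<^bsub>M\<^esub>}"
  have N': "\<And>i. i \<in> I \<Longrightarrow> N i \<subseteq> carrier M" using N additive_subgroupD(1) by blast
  have C: "\<And>j. j \<in> I \<Longrightarrow> x j \<in> carrier M" "\<And>j. j \<in> I \<Longrightarrow> y j \<in> carrier M"
    using x y N' by auto
  have xy: "\<And>j. j \<in> I \<Longrightarrow> x j \<in> N j" "\<And>j. j \<in> I \<Longrightarrow> y j \<in> N j" using x y by auto
  define S where "S = {i\<in>I. x i \<noteq> \<zero>\<^bsub>M\<^esub>} \<union> {i\<in>I. y i \<noteq> \<zero>\<^bsub>M\<^esub>}"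
  have S: "finite S" "S \<subseteq> I" using x y by (auto simp: S_def)
  have mS: "m = finsum M x S" "m = finsum M y S"
  proof -
    have *: "finsum M z {i\<in>I. z i \<noteq> \<zero>\<^bsub>M\<^esub>} = finsum M z S"
      if "{i\<in>I. z i \<noteq> \<zero>\<^bsub>M\<^esub>} \<subseteq> S" "\<And>j. j \<in> I \<Longrightarrow> z j \<in> carrier M" for z
      using that S by (intro add.finprod_mono_neutral_cong_left) auto
    show "m = finsum M x S" using x *[of x] C(1) by (simp add: S_def)
    show "m = finsum M y S" using y *[of y] C(2) by (simp add: S_def)
  qed
  have "x i = y i" if i: "i \<in> I" for i
  proof (cases "i \<in> S")
    case False
    then show ?thesis using i by (auto simp: S_def)
  next
    case True
    let ?T = "S - {i}"
    have T: "finite ?T" "i \<notin> ?T" "insert i ?T = S" "?T \<subseteq> I - {i}" using S True by auto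
    let ?x = "finsum M x ?T" and ?y = "finsum M y ?T"
    have "?x \<in> subgroup_sum M (I - {i}) N" "?y \<in> subgroup_sum M (I - {i}) N"
      using N' xy T by (auto intro!: finsum_in_subgroup_sum)
    moreover have sub: "additive_subgroup (subgroup_sum M (I - {i}) N) M"
      using N by (intro subgroup_sum_additive_subgroup) auto
    ultimately have diff: "?y \<ominus>\<^bsub>M\<^esub> ?x \<in> subgroup_sum M (I - {i}) N"
      and carr: "?x \<in> carrier M" "?y \<in> carrier M"
      using additive_subgroupD[OF sub] by auto
    have "m = x i \<oplus>\<^bsub>M\<^esub> ?x" "m = y i \<oplus>\<^bsub>M\<^esub> ?y"
      using mS T C i finsum_insert[of ?T i x] finsum_insert[of ?T i y] by auto
    then have eq: "x i \<oplus>\<^bsub>M\<^esub> ?x = y i \<oplus>\<^bsub>M\<^esub> ?y" by simp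
    have "x i \<ominus>\<^bsub>M\<^esub> y i = (x i \<oplus>\<^bsub>M\<^esub> ?x) \<oplus>\<^bsub>M\<^esub> (\<ominus>\<^bsub>M\<^esub> ?x \<oplus>\<^bsub>M\<^esub> \<ominus>\<^bsub>M\<^esub> y i)"
      using carr C[OF i] by (simp add: minus_eq a_assoc r_neg2 r_neg1)
    also have "\<dots> = ?y \<ominus>\<^bsub>M\<^esub> ?x"
      unfolding eq using carr C[OF i] by (simp add: minus_eq a_ac r_neg2 r_neg1)
    finally have "x i \<ominus>\<^bsub>M\<^esub> y i \<in> subgroup_sum M (I - {i}) N" using diff by simp
    then have "x i \<ominus>\<^bsub>M\<^esub> y i = \<zero>\<^bsub>M\<^esub>"
      using indep[OF i] additive_subgroupD(5)[OF N[OF i]] xy[OF i] by blast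
    then have "x i = \<zero>\<^bsub>M\<^esub> \<oplus>\<^bsub>M\<^esub> y i" using C[OF i] by (metis minus_eq a_assoc a_inv_closed l_neg r_zero)
    then show ?thesis using C[OF i] by simp
  qed
  then show "x = y" using x y by (intro PiE_ext[of x I N y]) auto
qed

lemma is_direct_sum_generates:
  assumes "abelian_group M" "is_direct_sum M I N"
  shows "carrier M \<subseteq> subgroup_sum M {i\<in>I. N i \<noteq> {\<zero>\<^bsub>M\<^esub>}} N"
proof
  interpret abelian_group M by fact
  fix m assume "m \<in> carrier M"
  then obtain x where x: "x \<in> (\<Pi>\<^sub>E i\<in>I. N i)" "finite {i\<in>I. x i \<noteq> \<zero>\<^bsub>M\<^esub>}"
      "m = finsum M x {i\<in>I. x i \<noteq> \<zero>\<^bsub>M\<^esub>}"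
    using assms(2) unfolding is_direct_sum_def by (meson ex1_implies_ex)
  have "\<And>i. i \<in> I \<Longrightarrow> N i \<subseteq> carrier M"
    using assms(2) additive_subgroupD(1) by (auto simp: is_direct_sum_def)
  then show "m \<in> subgroup_sum M {i\<in>I. N i \<noteq> {\<zero>\<^bsub>M\<^esub>}} N"
    unfolding x(3) using x by (intro finsum_in_subgroup_sum) auto
qed

lemma (in left_module) subgroup_sum_submodule:
  assumes N: "\<And>i. i \<in> I \<Longrightarrow> submodule (N i) R M"
  shows "submodule (subgroup_sum M I N) R M"
proof -
  have N': "\<And>i. i \<in> I \<Longrightarrow> N i \<subseteq> carrier M" using N by (simp add: submodule_iff)
  have "a \<odot>\<^bsub>M\<^esub> m \<in> subgroup_sum M I N" if "a \<in> carrier R" "m \<in> subgroup_sum M I N" for a m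
    using that(2)
  proof induction
    case zero
    then show ?case using that(1) by (simp add: smult_r_zero subgroup_sum.zero)
  next
    case (add i n m)
    have "n \<in> carrier M" "m \<in> carrier M" using add N' M.subgroup_sum_closed[OF N'] by auto
    then have "a \<odot>\<^bsub>M\<^esub> (n \<oplus>\<^bsub>M\<^esub> m) = a \<odot>\<^bsub>M\<^esub> n \<oplus>\<^bsub>M\<^esub> a \<odot>\<^bsub>M\<^esub> m" using that(1) by (simp add: smult_r_distr)
    then show ?case using add N[of i] that(1) by (auto simp: submodule_iff intro!: subgroup_sum.add)
  qed
  then show ?thesis
    unfolding submodule_iff
    by (auto intro: subgroup_sum.zero M.subgroup_sum_closed[OF N'] M.subgroup_sum_add[OF N'])
qed

lemma left_module_hom_subgroup_sum:
  assumes M: "left_module R M" and N: "left_module R M'" and f: "f \<in> left_module_hom R M M'"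
    and "\<And>i. i \<in> I \<Longrightarrow> N i \<subseteq> carrier M" and "m \<in> subgroup_sum M I N"
  shows "f m \<in> subgroup_sum M' I (\<lambda>i. f ` N i)"
  using assms(5)
proof induction
  case zero
  then show ?case by (simp add: left_module_hom_zero[OF M N f] subgroup_sum.zero)
next
  case (add i n m)
  interpret left_module R M by fact
  have "n \<in> carrier M" "m \<in> carrier M" using add assms(4) M.subgroup_sum_closed[OF assms(4)] by auto
  then show ?case using add left_module_hom_add[OF M N f, of n m]
    by (auto intro!: subgroup_sum.add)
qed

text \<open>
  Independence by annihilators: an element of the sum of the other subgroups is killed by a
  product of separating scalars, one for each of its terms, and such a product stays
  injective on \<open>N i\<close>.
\<close>

lemma (in left_module) separated_subgroups_independent:
  assumes N: "\<And>i. i \<in> I \<Longrightarrow> additive_subgroup (N i) M"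
    and sep: "\<And>i j x. i \<in> I \<Longrightarrow> j \<in> I \<Longrightarrow> i \<noteq> j \<Longrightarrow> x \<in> N j \<Longrightarrow>
      \<exists>a\<in>carrier R. a \<odot>\<^bsub>M\<^esub> x = \<zero>\<^bsub>M\<^esub> \<and> (\<forall>k\<in>I. \<forall>y\<in>N k. a \<odot>\<^bsub>M\<^esub> y \<in> N k)
        \<and> (\<forall>y\<in>N i. a \<odot>\<^bsub>M\<^esub> y = \<zero>\<^bsub>M\<^esub> \<longrightarrow> y = \<zero>\<^bsub>M\<^esub>)"
    and i: "i \<in> I" and y: "y \<in> N i" "y \<in> subgroup_sum M (I - {i}) N"
  shows "y = \<zero>\<^bsub>M\<^esub>"
proof -
  have N': "\<And>i. i \<in> I \<Longrightarrow> N i \<subseteq> carrier M" using N M.additive_subgroupD(1) by blast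
  have "\<exists>a\<in>carrier R. a \<odot>\<^bsub>M\<^esub> m = \<zero>\<^bsub>M\<^esub> \<and> (\<forall>k\<in>I. \<forall>y\<in>N k. a \<odot>\<^bsub>M\<^esub> y \<in> N k)
      \<and> (\<forall>y\<in>N i. a \<odot>\<^bsub>M\<^esub> y = \<zero>\<^bsub>M\<^esub> \<longrightarrow> y = \<zero>\<^bsub>M\<^esub>)"
    if "m \<in> subgroup_sum M (I - {i}) N" for m
    using that
  proof induction
    case zero
    have "\<forall>k\<in>I. \<forall>y\<in>N k. \<one>\<^bsub>R\<^esub> \<odot>\<^bsub>M\<^esub> y = y" using N' smult_one by blast
    then show ?case using i by (intro bexI[of _ "\<one>\<^bsub>R\<^esub>"]) (auto simp: smult_r_zero)
  next
    case (add j n m)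
    then obtain a where a: "a \<in> carrier R" "a \<odot>\<^bsub>M\<^esub> m = \<zero>\<^bsub>M\<^esub>" "\<forall>k\<in>I. \<forall>y\<in>N k. a \<odot>\<^bsub>M\<^esub> y \<in> N k"
      "\<forall>y\<in>N i. a \<odot>\<^bsub>M\<^esub> y = \<zero>\<^bsub>M\<^esub> \<longrightarrow> y = \<zero>\<^bsub>M\<^esub>" by blast
    have "a \<odot>\<^bsub>M\<^esub> n \<in> N j" using a add by blast
    then obtain b where b: "b \<in> carrier R" "b \<odot>\<^bsub>M\<^esub> (a \<odot>\<^bsub>M\<^esub> n) = \<zero>\<^bsub>M\<^esub>"
      "\<forall>k\<in>I. \<forall>y\<in>N k. b \<odot>\<^bsub>M\<^esub> y \<in> N k" "\<forall>y\<in>N i. b \<odot>\<^bsub>M\<^esub> y = \<zero>\<^bsub>M\<^esub> \<longrightarrow> y = \<zero>\<^bsub>M\<^esub>"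
      using sep[of i j] i add(1) by blast
    have nm: "n \<in> carrier M" "m \<in> carrier M"
      using add N' M.subgroup_sum_closed[of "I - {i}" N m] by auto
    have assoc: "(b \<otimes>\<^bsub>R\<^esub> a) \<odot>\<^bsub>M\<^esub> y = b \<odot>\<^bsub>M\<^esub> (a \<odot>\<^bsub>M\<^esub> y)" if "y \<in> carrier M" for y
      using smult_assoc a b that by blast
    have assocN: "\<forall>k\<in>I. \<forall>y\<in>N k. (b \<otimes>\<^bsub>R\<^esub> a) \<odot>\<^bsub>M\<^esub> y = b \<odot>\<^bsub>M\<^esub> (a \<odot>\<^bsub>M\<^esub> y)"
      using assoc N' by blast
    show ?case
    proof (intro bexI[of _ "b \<otimes>\<^bsub>R\<^esub> a"] conjI)
      show "(b \<otimes>\<^bsub>R\<^esub> a) \<odot>\<^bsub>M\<^esub> (n \<oplus>\<^bsub>M\<^esub> m) = \<zero>\<^bsub>M\<^esub>"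
        using nm a b by (simp add: assoc smult_r_distr smult_closed smult_r_zero)
      show "\<forall>k\<in>I. \<forall>y\<in>N k. (b \<otimes>\<^bsub>R\<^esub> a) \<odot>\<^bsub>M\<^esub> y \<in> N k" using assocN a(3) b(3) by simp
      show "\<forall>y\<in>N i. (b \<otimes>\<^bsub>R\<^esub> a) \<odot>\<^bsub>M\<^esub> y = \<zero>\<^bsub>M\<^esub> \<longrightarrow> y = \<zero>\<^bsub>M\<^esub>"
        using assocN i a(3,4) b(4) by metis
    qed (use a b in auto)
  qed
  from this[OF y(2)] show ?thesis using y(1) by blast
qed

section \<open>The algebra $U_{g,h}$ and its central subalgebra\<close>

lemma ring_of_type_algebra_simps [simp]:
  "carrier ring_of_type_algebra = UNIV" "x \<otimes>\<^bsub>ring_of_type_algebra\<^esub> y = x * y"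
  "x \<oplus>\<^bsub>ring_of_type_algebra\<^esub> y = x + y" "\<zero>\<^bsub>ring_of_type_algebra\<^esub> = 0" "\<one>\<^bsub>ring_of_type_algebra\<^esub> = 1"
  by (simp_all add: ring_of_type_algebra_def)

lemma ring_ring_of_type_algebra: "ring (ring_of_type_algebra :: 'a::ring_1 ring)"
proof -
  have "\<exists>y. x + y = 0" for x :: 'a by (rule exI[of _ "- x"]) simp
  then show ?thesis
    unfolding ring_of_type_algebra_def
    by unfold_locales (auto simp: algebra_simps Units_def)
qed

lemma gh_ideal_ideal: "ideal (gh_ideal q) ring_of_type_algebra"
  unfolding gh_ideal_def by (rule ring.genideal_ideal[OF ring_ring_of_type_algebra]) simp

lemma ring_U_gh: "ring (U_gh q)"
  unfolding U_gh_def by (rule ideal.quotient_is_ring[OF gh_ideal_ideal])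

lemma cls_ring_hom: "cls q \<in> ring_hom ring_of_type_algebra (U_gh q)"
  using ideal.rcos_ring_hom[OF gh_ideal_ideal, of q] unfolding U_gh_def cls_def by (simp add: eta_contract_eq)

lemma cls_mult: "cls q (x * y) = cls q x \<otimes>\<^bsub>U_gh q\<^esub> cls q y"
  and cls_add: "cls q (x + y) = cls q x \<oplus>\<^bsub>U_gh q\<^esub> cls q y"
  and cls_one: "cls q 1 = \<one>\<^bsub>U_gh q\<^esub>"
  and cls_closed [simp]: "cls q x \<in> carrier (U_gh q)"
  using ring_hom_mult[OF cls_ring_hom] ring_hom_add[OF cls_ring_hom] ring_hom_one[OF cls_ring_hom]
    ring_hom_closed[OF cls_ring_hom] by simp_all

lemma carrier_U_gh: "carrier (U_gh q) = range (cls q)"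
  unfolding U_gh_def cls_def by (auto simp: FactRing_def A_RCOSETS_def' a_r_coset_def')

lemma cls_eq_zero: "x \<in> gh_ideal q \<Longrightarrow> cls q x = \<zero>\<^bsub>U_gh q\<^esub>"
proof -
  interpret I: ideal "gh_ideal q" ring_of_type_algebra by (rule gh_ideal_ideal)
  assume "x \<in> gh_ideal q"
  then have "cls q x = gh_ideal q"
    unfolding cls_def using I.a_subgroup by (intro I.a_coset_join2) auto
  then show ?thesis by (simp add: U_gh_def FactRing_def)
qed

lemma cls_zero: "cls q 0 = \<zero>\<^bsub>U_gh q\<^esub>"
  using additive_subgroup.zero_closed[OF ideal.axioms(1)[OF gh_ideal_ideal]]
  by (intro cls_eq_zero) simp

lemma cls_minus: "cls q (- x) = \<ominus>\<^bsub>U_gh q\<^esub> cls q x"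
proof -
  interpret ring "U_gh q" by (rule ring_U_gh)
  have "cls q (- x) \<oplus>\<^bsub>U_gh q\<^esub> cls q x = \<zero>\<^bsub>U_gh q\<^esub>"
    by (simp flip: cls_add add: cls_zero)
  then show ?thesis by (metis minus_equality cls_closed)
qed

lemma cls_diff: "cls q (x - y) = cls q x \<ominus>\<^bsub>U_gh q\<^esub> cls q y"
proof -
  interpret ring "U_gh q" by (rule ring_U_gh)
  show ?thesis using cls_add[of q x "- y"] by (simp add: cls_minus minus_eq)
qed

lemma cls_power: "cls q (x ^ n) = cls q x [^]\<^bsub>U_gh q\<^esub> n"
proof -
  interpret ring "U_gh q" by (rule ring_U_gh)
  show ?thesis by (induction n) (simp_all add: cls_one power_Suc2 cls_mult del: power_Suc)
qed

lemma const_0 [simp]: "const 0 = 0" and const_1 [simp]: "const 1 = 1"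
  and const_add: "const (a + b) = const a + const b"
  and const_minus: "const (- a) = - const a"
  and const_diff: "const (a - b) = const a - const b"
  and const_mult: "const (a * b) = const a * const b"
  by (simp_all add: const_def single_add single_uminus single_diff mult_single)

lemma poly_mapping_single_induct [case_names zero single]:
  assumes "P 0" "\<And>w c f. P f \<Longrightarrow> P (Poly_Mapping.single w c + f)"
  shows "P f"
proof (induction f rule: update_induct)
  case (update f w c)
  have "Poly_Mapping.update w c f = Poly_Mapping.single w c + f"
    using update(1) by (intro poly_mapping_eqI)
      (auto simp: lookup_update lookup_add lookup_single in_keys_iff)
  then show ?case using assms(2) update(3) by simp
qed (rule assms(1))

lemma const_commute: "x * const c = const c * (x :: 'k::field free_gh)"
proof (induction x rule: poly_mapping_single_induct)
  case (single w a x)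
  have "Poly_Mapping.single w a * const c = const c * Poly_Mapping.single w a"
    by (simp add: const_def mult_single mult.commute)
  then show ?case using single by (simp add: distrib_left distrib_right)
qed simp

lemma free_gh_induct [case_names const gen add mult]:
  fixes x :: "'k::field free_gh"
  assumes "\<And>c. P (const c)" "\<And>a. P (gen a)" "\<And>x y. P x \<Longrightarrow> P y \<Longrightarrow> P (x + y)"
    "\<And>x y. P x \<Longrightarrow> P y \<Longrightarrow> P (x * y)"
  shows "P x"
proof (induction x rule: poly_mapping_single_induct)
  case zero
  then show ?case using assms(1)[of 0] by simp
next
  case (single w c x)
  have word: "P (Poly_Mapping.single (Word as) c)" for as
  proof (induction as arbitrary: c)
    case Nil
    then show ?case using assms(1)[of c] by (simp add: const_def zero_gh_word_def)
  next
    case (Cons a as)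
    have "Poly_Mapping.single (Word (a # as)) c = gen a * Poly_Mapping.single (Word as) c"
      by (simp add: gen_def mult_single plus_gh_word_def)
    then show ?case using assms(2,4) Cons by simp
  qed
  then show ?case using word[of "letters w"] single assms(3) by simp
qed

text \<open>
  Vanishing in \<open>U_gh q\<close>: the identities below are checked by writing a difference in the
  free algebra explicitly as a combination of elements known to vanish.
\<close>

definition vanishes :: "'k::field \<Rightarrow> 'k free_gh \<Rightarrow> bool" where
  "vanishes q x \<longleftrightarrow> cls q x = \<zero>\<^bsub>U_gh q\<^esub>"

lemma vanishes_relation: "x \<in> gh_relations q \<Longrightarrow> vanishes q x"
  unfolding vanishes_def gh_ideal_def
  using ring.genideal_self[OF ring_ring_of_type_algebra, of "gh_relations q"]
  by (intro cls_eq_zero) (auto simp: gh_ideal_def)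

lemma vanishes_zero: "vanishes q 0"
  by (simp add: vanishes_def cls_zero)

lemma vanishes_diff_iff: "vanishes q (x - y) \<longleftrightarrow> cls q x = cls q y"
proof -
  interpret ring "U_gh q" by (rule ring_U_gh)
  have "cls q x = cls q (x - y) \<oplus>\<^bsub>U_gh q\<^esub> cls q y" by (simp flip: cls_add)
  moreover have "cls q y \<ominus>\<^bsub>U_gh q\<^esub> cls q y = \<zero>\<^bsub>U_gh q\<^esub>" by (simp add: minus_eq r_neg)
  ultimately show ?thesis unfolding vanishes_def by (metis cls_closed cls_diff l_zero)
qed

lemma vanishes_add: "vanishes q x \<Longrightarrow> vanishes q y \<Longrightarrow> vanishes q (x + y)"
  and vanishes_diff: "vanishes q x \<Longrightarrow> vanishes q y \<Longrightarrow> vanishes q (x - y)"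
  and vanishes_left: "vanishes q y \<Longrightarrow> vanishes q (x * y)"
  and vanishes_right: "vanishes q x \<Longrightarrow> vanishes q (x * y)"
proof -
  interpret ring "U_gh q" by (rule ring_U_gh)
  show "vanishes q x \<Longrightarrow> vanishes q y \<Longrightarrow> vanishes q (x + y)"
    "vanishes q x \<Longrightarrow> vanishes q y \<Longrightarrow> vanishes q (x - y)"
    "vanishes q y \<Longrightarrow> vanishes q (x * y)" "vanishes q x \<Longrightarrow> vanishes q (x * y)"
    by (simp_all add: vanishes_def cls_add cls_diff cls_mult minus_eq r_neg)
qed

lemmas vanishes_intros = vanishes_add vanishes_diff vanishes_left vanishes_right

definition central :: "'k::field \<Rightarrow> 'k free_gh set \<Rightarrow> bool" where
  "central q z \<longleftrightarrow> z \<in> carrier (U_gh q)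
     \<and> (\<forall>u\<in>carrier (U_gh q). u \<otimes>\<^bsub>U_gh q\<^esub> z = z \<otimes>\<^bsub>U_gh q\<^esub> u)"

text \<open>
  The elements that commute with \<open>x\<close> form a subalgebra, so it is enough to test generators.
\<close>

lemma central_clsI:
  assumes "\<And>a. vanishes q (gen a * x - x * gen a)"
  shows "central q (cls q x)"
proof -
  have "vanishes q (y * x - x * y)" for y
  proof (induction y rule: free_gh_induct)
    case (const c)
    then show ?case by (simp add: const_commute vanishes_zero)
  next
    case (gen a)
    then show ?case by (rule assms)
  next
    case (add y z)
    have "(y + z) * x - x * (y + z) = (y * x - x * y) + (z * x - x * z)"
      by (simp add: algebra_simps)
    then show ?case using add vanishes_add by metis
  next
    case (mult y z)
    have "(y * z) * x - x * (y * z) = y * (z * x - x * z) + (y * x - x * y) * z"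
      by (simp add: algebra_simps)
    then show ?case using mult by (metis vanishes_intros)
  qed
  then have "cls q (y * x) = cls q (x * y)" for y by (simp add: vanishes_diff_iff)
  then show ?thesis
    unfolding central_def carrier_U_gh by (auto simp flip: cls_mult)
qed

lemma central_clsD: "central q (cls q x) \<Longrightarrow> vanishes q (x * y - y * x)"
  by (simp add: central_def vanishes_diff_iff cls_mult)

lemma central_generate_ring:
  assumes "\<And>s. s \<in> S \<Longrightarrow> central q s" "z \<in> generate_ring (U_gh q) S"
  shows "central q z"
proof -
  interpret ring "U_gh q" by (rule ring_U_gh)
  show ?thesis
    using assms(2)
  proof induction
    case (eng_mult x y)
    then show ?case unfolding central_def by (metis m_assoc m_closed)
  qed (use assms(1) in \<open>auto simp: central_def r_minus l_minus r_distr l_distr\<close>)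
qed

lemma vanishes_uminus: "vanishes q x \<Longrightarrow> vanishes q (- x)"
  using vanishes_diff[of q 0 x] by (simp add: vanishes_zero)

lemma vanishes_commute: "vanishes q (x * y - y * x) \<Longrightarrow> vanishes q (y * x - x * y)"
  using vanishes_uminus[of q "x * y - y * x"] by simp

lemma vanishes_commute_inverse:
  assumes "vanishes q (x * x' - 1)" "vanishes q (x' * x - 1)" "vanishes q (x * z - z * x)"
  shows "vanishes q (x' * z - z * x')"
proof -
  have "x' * z - z * x' = (x' * x - 1) * (z * x') - (x' * z) * (x * x' - 1)
      - x' * ((x * z - z * x) * x')"
    by (simp add: algebra_simps)
  then show ?thesis using assms by (metis vanishes_intros)
qed

context
  fixes q :: "'k::field" and E F K K' G G' H H' :: "'k free_gh"
  defines "E \<equiv> gen Gen_E" and "F \<equiv> gen Gen_F" and "K \<equiv> gen Gen_K" and "K' \<equiv> gen Gen_K_inv"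
    and "G \<equiv> gen Gen_g" and "G' \<equiv> gen Gen_g_inv" and "H \<equiv> gen Gen_h" and "H' \<equiv> gen Gen_h_inv"
begin

lemma relations_vanish:
  "vanishes q (K * K' - 1)" "vanishes q (K' * K - 1)"
  "vanishes q (G * G' - 1)" "vanishes q (G' * G - 1)"
  "vanishes q (H * H' - 1)" "vanishes q (H' * H - 1)"
  "vanishes q (G * H - H * G)"
  "vanishes q (G * E - E * G)" "vanishes q (G * F - F * G)" "vanishes q (G * K - K * G)"
  "vanishes q (H * E - E * H)" "vanishes q (H * F - F * H)" "vanishes q (H * K - K * H)"
  "vanishes q (K * E * K' - const (q\<^sup>2) * E)"
  "vanishes q (K * F * K' - const (inverse (q\<^sup>2)) * F)"
  "vanishes q ((E * F - F * E) - const (1 / (q - inverse q)) * (K - K' * G\<^sup>2))"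
  by (rule vanishes_relation; simp add: gh_relations_def Let_def E_def F_def K_def K'_def G_def
      G'_def H_def H'_def)+

text \<open>
  Commuting with an invertible element implies commuting with its inverse, which leaves the five
  generators other than inverses.
\<close>

lemma vanishes_gen_cases:
  assumes "vanishes q (E * x - x * E)" "vanishes q (F * x - x * F)" "vanishes q (K * x - x * K)"
    "vanishes q (G * x - x * G)" "vanishes q (H * x - x * H)"
  shows "vanishes q (gen a * x - x * gen a)"
  using assms vanishes_commute_inverse relations_vanish(1-6)
  by (cases a) (auto simp: E_def F_def K_def K'_def G_def G'_def H_def H'_def)

lemma central_gens:
  "central q (cls q G)" "central q (cls q G')" "central q (cls q H)" "central q (cls q H')"
proof -
  note r = relations_vanish
  have g: "vanishes q (gen a * G - G * gen a)" for a
    by (intro vanishes_gen_cases) (use r(7-10) vanishes_commute vanishes_zero in auto)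
  have h: "vanishes q (gen a * H - H * gen a)" for a
    by (intro vanishes_gen_cases) (use r(7,11-13) vanishes_commute vanishes_zero in auto)
  show "central q (cls q G)" "central q (cls q H)" using g h by (auto intro: central_clsI)
  show "central q (cls q G')" "central q (cls q H')"
    by (intro central_clsI vanishes_commute[OF vanishes_commute_inverse[OF r(3,4)]]
        vanishes_commute[OF vanishes_commute_inverse[OF r(5,6)]]
        vanishes_commute[OF g] vanishes_commute[OF h])+
qed

text \<open>
  The relation \<open>K x K' = c x\<close> multiplied by \<open>K\<close> on the right, and by \<open>K'\<close> on the left.
\<close>

lemma K_commutation:
  assumes "vanishes q (K * x * K' - c * x)" "c = const d"
  shows "vanishes q (K * x - c * x * K)" "vanishes q (x * K' - c * K' * x)"
proof -
  note r = relations_vanish(1,2)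
  have "K * x - c * x * K = (K * x * K' - c * x) * K - (K * x) * (K' * K - 1)"
    by (simp add: algebra_simps)
  then show "vanishes q (K * x - c * x * K)" using assms r by (metis vanishes_intros)
  have "x * K' - c * K' * x = K' * (K * x * K' - c * x) - (K' * K - 1) * (x * K')"
    using const_commute[of K' d] assms(2) by (simp add: algebra_simps flip: mult.assoc)
  then show "vanishes q (x * K' - c * K' * x)" using assms r by (metis vanishes_intros)
qed

end

text \<open>
  With \<open>c = 1 / (q - inverse q)\<close> the element \<open>C\<close> is \<open>F E + u K + v K' g\<^sup>2\<close> for \<open>u = c\<^sup>2 q\<close> and
  \<open>v = c\<^sup>2 / q\<close>. Commuting \<open>E\<close> or \<open>F\<close> with \<open>F E\<close> produces \<open>c (K - K' g\<^sup>2)\<close>, while moving it past \<open>K\<close> or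
  \<open>K'\<close> exchanges \<open>u\<close> and \<open>v\<close>; the two effects cancel because \<open>c = u - v\<close>.
\<close>

lemma central_casimir:
  fixes q :: "'k::field"
  assumes "q \<noteq> 0" "q\<^sup>2 \<noteq> 1"
  shows "central q (casimir q)"
proof -
  define E F K K' G where "E = (gen Gen_E :: 'k free_gh)" and "F = (gen Gen_F :: 'k free_gh)"
    and "K = (gen Gen_K :: 'k free_gh)" and "K' = (gen Gen_K_inv :: 'k free_gh)"
    and "G = (gen Gen_g :: 'k free_gh)"
  note r = relations_vanish[of q, folded E_def F_def K_def K'_def G_def]
  define c where "c = 1 / (q - inverse q)"
  define u v where "u = c\<^sup>2 * q" and "v = c\<^sup>2 * inverse q"
  have "q - inverse q \<noteq> 0" using assms by (auto simp: field_simps power2_eq_square)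
  then have "c * (q - inverse q) = 1" by (simp add: c_def)
  then have c_eq: "c = u - v" by (simp add: u_def v_def power2_eq_square mult.assoc flip: right_diff_distrib)
  define U V where "U = const u" and "V = const v"
  define Q P where "Q = const (q\<^sup>2)" and "P = const (inverse (q\<^sup>2))"
  have UP: "U * P = V" and VQ: "V * Q = U" and PQ: "P * Q = 1"
  proof -
    have "u * inverse (q\<^sup>2) = v" "v * q\<^sup>2 = u" "inverse (q\<^sup>2) * q\<^sup>2 = 1"
      using assms(1) by (simp_all add: u_def v_def power2_eq_square field_simps)
    then show "U * P = V" "V * Q = U" "P * Q = 1"
      by (simp_all add: U_def V_def Q_def P_def flip: const_mult)
  qed
  define C where "C = F * E + U * K + V * K' * G\<^sup>2"
  have C: "casimir q = cls q C"
  proof -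
    have "1 / (q - inverse q)\<^sup>2 = c\<^sup>2" by (simp add: c_def power_divide)
    then show ?thesis
      unfolding casimir_def C_def U_def V_def u_def v_def const_mult E_def F_def K_def K'_def G_def
      by (simp only: distrib_left mult.assoc add.assoc)
  qed
  have comm: "x * U = U * x" "x * V = V * x" "x * P = P * x" "x * Q = Q * x"
    "x * (U * y) = U * (x * y)" "x * (V * y) = V * (x * y)"
    "x * (P * y) = P * (x * y)" "x * (Q * y) = Q * (x * y)" for x y
    unfolding U_def V_def Q_def P_def by (simp_all only: const_commute flip: mult.assoc)
  have rel: "vanishes q ((E * F - F * E) - (U - V) * (K - K' * G\<^sup>2))"
    using r(16) c_eq by (simp add: U_def V_def c_def const_diff)
  note KE = K_commutation[of q E "Q", folded K_def K'_def, OF r(14)[folded Q_def] Q_def]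
  note KF = K_commutation[of q F "P", folded K_def K'_def, OF r(15)[folded P_def] P_def]
  have G2: "vanishes q (x * G\<^sup>2 - G\<^sup>2 * x)" for x
  proof -
    have "x * G\<^sup>2 - G\<^sup>2 * x = (x * G - G * x) * G + G * (x * G - G * x)"
      by (simp add: algebra_simps power2_eq_square)
    moreover have "vanishes q (x * G - G * x)"
      using central_gens(1)[of q] vanishes_commute central_clsD unfolding G_def by blast
    ultimately show ?thesis by (metis vanishes_intros)
  qed
  note s = algebra_simps comm[of E] comm[of F] comm[of K] comm[of K'] comm[of G]
  have "E * C - C * E = ((E * F - F * E) - (U - V) * (K - K' * G\<^sup>2)) * E
      - V * (K * E - Q * E * K) + V * ((E * K' - Q * K' * E) * G\<^sup>2) + U * (K' * (E * G\<^sup>2 - G\<^sup>2 * E))"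
    unfolding C_def VQ[symmetric] by (simp add: s)
  then have "vanishes q (E * C - C * E)"
    by (simp only: vanishes_intros rel KE G2)
  moreover have "F * C - C * F = - (F * ((E * F - F * E) - (U - V) * (K - K' * G\<^sup>2)))
      - U * (K * F - P * F * K) + U * ((F * K' - P * K' * F) * G\<^sup>2) + V * (K' * (F * G\<^sup>2 - G\<^sup>2 * F))"
    unfolding C_def UP[symmetric] by (simp add: s)
  then have "vanishes q (F * C - C * F)"
    by (simp only: vanishes_intros vanishes_uminus rel KF G2)
  moreover have "K * C - C * K = (K * F - P * F * K) * E + P * (F * (K * E - Q * E * K))
      + V * ((K * K' - 1) * G\<^sup>2 - (K' * K - 1) * G\<^sup>2 + K' * (K * G\<^sup>2 - G\<^sup>2 * K))"
  proof -
    have "P * (Q * x) = x" for x using PQ by (simp flip: mult.assoc)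
    then show ?thesis unfolding C_def by (simp add: s)
  qed
  then have "vanishes q (K * C - C * K)"
    by (simp only: vanishes_intros r(1,2) KE KF G2)
  ultimately have "vanishes q (gen a * C - C * gen a)" for a
    using central_clsD[OF central_gens(1)] central_clsD[OF central_gens(3)]
    unfolding E_def F_def K_def by (rule vanishes_gen_cases)
  then show ?thesis unfolding C by (rule central_clsI)
qed

lemma Z_gh_central:
  assumes "q \<noteq> 0" "q\<^sup>2 \<noteq> 1" "z \<in> Z_gh q"
  shows "central q z"
proof (rule central_generate_ring)
  show "z \<in> generate_ring (U_gh q) (range (uscal q)
      \<union> ({casimir q} \<union> ugen q ` {Gen_g, Gen_g_inv, Gen_h, Gen_h_inv}))"
    using assms(3) unfolding Z_gh_def subalg_def .
next
  fix s assume "s \<in> range (uscal q)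
      \<union> ({casimir q} \<union> ugen q ` {Gen_g, Gen_g_inv, Gen_h, Gen_h_inv})"
  moreover have "central q (uscal q c)" for c
    by (rule central_clsI) (simp add: const_commute vanishes_zero)
  ultimately show "central q s"
    using central_gens central_casimir[OF assms(1,2)] by auto
qed

lemma Z_gh_carrier: "Z_gh q \<subseteq> carrier (U_gh q)"
proof -
  interpret ring "U_gh q" by (rule ring_U_gh)
  show ?thesis unfolding Z_gh_def subalg_def
    by (rule generate_ring_incl) (auto simp: casimir_def)
qed

lemma Z_gh_closed:
  shows "\<one>\<^bsub>U_gh q\<^esub> \<in> Z_gh q" and "uscal q c \<in> Z_gh q"
    and "x \<in> Z_gh q \<Longrightarrow> y \<in> Z_gh q \<Longrightarrow> x \<oplus>\<^bsub>U_gh q\<^esub> y \<in> Z_gh q"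
    and "x \<in> Z_gh q \<Longrightarrow> y \<in> Z_gh q \<Longrightarrow> x \<otimes>\<^bsub>U_gh q\<^esub> y \<in> Z_gh q"
  unfolding Z_gh_def subalg_def by (auto intro: generate_ring.intros)

lemma Z_gh_power_diff:
  assumes "z \<in> Z_gh q"
  shows "(z \<ominus>\<^bsub>U_gh q\<^esub> uscal q s) [^]\<^bsub>U_gh q\<^esub> (n::nat) \<in> Z_gh q"
proof -
  interpret ring "U_gh q" by (rule ring_U_gh)
  have "z \<oplus>\<^bsub>U_gh q\<^esub> uscal q (- s) \<in> Z_gh q" using assms Z_gh_closed by blast
  then have "z \<ominus>\<^bsub>U_gh q\<^esub> uscal q s \<in> Z_gh q" by (simp add: minus_eq const_minus cls_minus)
  then show ?thesis by (induction n) (auto intro: Z_gh_closed)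
qed

lemma central_chars_differ:
  assumes "\<mu> \<in> central_chars q" "\<nu> \<in> central_chars q" "\<mu> \<noteq> \<nu>"
  obtains z where "z \<in> Z_gh q" "\<mu> z \<noteq> \<nu> z"
  using assms extensionalityI[of \<mu> "Z_gh q" \<nu>] unfolding central_chars_def by blast

lemma B_plus_closed:
  shows "B_plus q \<subseteq> carrier (U_gh q)" and "\<zero>\<^bsub>U_gh q\<^esub> \<in> B_plus q" and "uscal q c \<in> B_plus q"
    and "x \<in> B_plus q \<Longrightarrow> y \<in> B_plus q \<Longrightarrow> x \<oplus>\<^bsub>U_gh q\<^esub> y \<in> B_plus q"
    and "x \<in> B_plus q \<Longrightarrow> y \<in> B_plus q \<Longrightarrow> x \<otimes>\<^bsub>U_gh q\<^esub> y \<in> B_plus q"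
proof -
  interpret ring "U_gh q" by (rule ring_U_gh)
  show "B_plus q \<subseteq> carrier (U_gh q)"
    unfolding B_plus_def subalg_def by (rule generate_ring_incl) auto
  show "\<zero>\<^bsub>U_gh q\<^esub> \<in> B_plus q" unfolding B_plus_def subalg_def by (rule zero_in_generate)
qed (auto simp: B_plus_def subalg_def intro: generate_ring.intros)

section \<open>Polynomials in an element of the free algebra\<close>

text \<open>
  Evaluation by the Horner scheme: the free algebra is not commutative, so \<open>poly\<close> cannot be used.
\<close>

definition peval :: "'k::field free_gh \<Rightarrow> 'k poly \<Rightarrow> 'k free_gh" where
  "peval x p = fold_coeffs (\<lambda>a y. const a + x * y) p 0"

lemma peval_0 [simp]: "peval x 0 = 0"
  by (simp add: peval_def)

lemma peval_pCons: "peval x (pCons a p) = const a + x * peval x p"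
  by (cases "p = 0 \<and> a = 0") (auto simp: peval_def)

lemma peval_linear: "peval x [:- a, 1:] = x - const a"
  by (simp add: peval_pCons const_minus)

lemma peval_1 [simp]: "peval x 1 = 1"
  by (simp add: one_pCons peval_pCons)

lemma peval_add: "peval x (p + r) = peval x p + peval x r"
  by (induction p r rule: poly_induct2) (simp_all add: peval_pCons const_add algebra_simps)

lemma peval_smult: "peval x (smult c p) = const c * peval x p"
proof (induction p)
  case (pCons a p)
  have "x * (const c * y) = const c * (x * y)" for y
    by (simp only: const_commute flip: mult.assoc)
  then show ?case using pCons by (simp add: peval_pCons const_mult distrib_left)
qed simp

lemma peval_minus: "peval x (- p) = - peval x p"
  using peval_smult[of x "-1" p] by (simp add: const_minus)

lemma peval_diff: "peval x (p - r) = peval x p - peval x r"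
  using peval_add[of x p "- r"] by (simp add: peval_minus)

lemma peval_mult: "peval x (p * r) = peval x p * peval x r"
  by (induction p) (simp_all add: peval_pCons peval_add peval_smult distrib_right mult.assoc)

lemma peval_power: "peval x (p ^ n) = peval x p ^ n"
  by (induction n) (simp_all add: peval_mult)

lemma cls_peval_linear_power:
  "cls q (peval x ([:- a, 1:] ^ n)) = (cls q x \<ominus>\<^bsub>U_gh q\<^esub> uscal q a) [^]\<^bsub>U_gh q\<^esub> n"
  by (simp add: peval_power peval_linear cls_power cls_diff)

lemma linear_power_bezout:
  fixes r :: "'k::field poly"
  assumes "poly r a \<noteq> 0"
  obtains u v where "u * [:- a, 1:] ^ n + v * r = 1"
proof -
  let ?c = "poly r a" and ?l = "[:- a, 1:]"
  define s where "s = smult (- inverse ?c) (synthetic_div r a)"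
  \<comment> \<open>Modulo \<open>r\<close> the polynomial \<open>s * ?l\<close> is 1, hence so is its \<open>n\<close>-th power.\<close>
  have "smult (inverse ?c) r = smult (inverse ?c) (?l * synthetic_div r a) + [:1:]"
    using assms by (subst synthetic_div_correct'[of a r, symmetric]) (simp add: smult_add_right)
  then have "1 - s * ?l = smult (inverse ?c) r"
    by (simp add: s_def one_pCons mult.commute)
  then have "r dvd 1 - s * ?l" by (metis dvd_refl dvd_smult)
  moreover have "1 - s * ?l dvd 1 ^ n - (s * ?l) ^ n"
    unfolding power_diff_sumr2 by (rule dvd_triv_left)
  ultimately have "r dvd 1 ^ n - (s * ?l) ^ n" by (rule dvd_trans)
  then obtain v where "1 ^ n - (s * ?l) ^ n = r * v" by (rule dvdE)
  then have "1 - (s * ?l) ^ n = v * r" by (simp only: power_one mult.commute)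
  then have "s ^ n * ?l ^ n + v * r = 1"
    by (metis add_diff_cancel_left' diff_add_cancel power_mult_distrib add.commute)
  then show ?thesis by (rule that)
qed

section \<open>Modules over $U_{g,h}$: weights and primary components\<close>

text \<open>
  The submodules over this subring are the linear subspaces.
\<close>

abbreviation scalars :: "'k::field \<Rightarrow> 'k free_gh set ring" where
  "scalars q \<equiv> (U_gh q)\<lparr>carrier := range (uscal q)\<rparr>"

lemma subring_scalars: "subring (range (uscal q)) (U_gh q)"
proof -
  interpret ring "U_gh q" by (rule ring_U_gh)
  show ?thesis
    by (rule subringI) (auto simp flip: cls_one cls_minus cls_add cls_mult const_minus const_add
        const_mult const_1)
qed

text \<open>
  The candidate for the summand of \<open>M\<close> in the block of \<open>\<nu>\<close>.
\<close>

definition primary_component ::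
    "'k::field \<Rightarrow> ('k free_gh set, 'm) module \<Rightarrow> ('k free_gh set \<Rightarrow> 'k) \<Rightarrow> 'm set" where
  "primary_component q M \<nu> = {m \<in> carrier M. \<forall>z\<in>Z_gh q. \<exists>n::nat.
     ((z \<ominus>\<^bsub>U_gh q\<^esub> uscal q (\<nu> z)) [^]\<^bsub>U_gh q\<^esub> n) \<odot>\<^bsub>M\<^esub> m = \<zero>\<^bsub>M\<^esub>}"

locale U_module = left_module "U_gh q" M
  for q :: "'k::field" and M :: "('k free_gh set, 'm) module"
begin

abbreviation act (infixr \<open>\<cdot>\<close> 75) where
  "x \<cdot> m \<equiv> cls q x \<odot>\<^bsub>M\<^esub> m"

lemma act_closed [simp]: "m \<in> carrier M \<Longrightarrow> x \<cdot> m \<in> carrier M"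
  by (simp add: smult_closed)

lemma
  assumes "m \<in> carrier M"
  shows act_mult: "(x * y) \<cdot> m = x \<cdot> y \<cdot> m"
    and act_add: "(x + y) \<cdot> m = x \<cdot> m \<oplus>\<^bsub>M\<^esub> y \<cdot> m"
    and act_diff: "(x - y) \<cdot> m = x \<cdot> m \<ominus>\<^bsub>M\<^esub> y \<cdot> m"
    and act_one: "1 \<cdot> m = m"
    and act_zero: "0 \<cdot> m = \<zero>\<^bsub>M\<^esub>"
  using assms
  by (simp_all add: cls_mult cls_add cls_diff cls_one cls_zero smult_assoc smult_l_distr
      smult_l_diff smult_one smult_l_zero)

lemma act_zero_right [simp]: "x \<cdot> \<zero>\<^bsub>M\<^esub> = \<zero>\<^bsub>M\<^esub>"
  by (simp add: smult_r_zero)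

lemma act_add_right:
  "m \<in> carrier M \<Longrightarrow> m' \<in> carrier M \<Longrightarrow> x \<cdot> (m \<oplus>\<^bsub>M\<^esub> m') = x \<cdot> m \<oplus>\<^bsub>M\<^esub> x \<cdot> m'"
  by (simp add: smult_r_distr)

lemma scalar_act_eq_zero:
  assumes "m \<in> carrier M" "const c \<cdot> m = \<zero>\<^bsub>M\<^esub>" "c \<noteq> 0"
  shows "m = \<zero>\<^bsub>M\<^esub>"
proof -
  have "(const (inverse c) * const c) \<cdot> m = \<zero>\<^bsub>M\<^esub>" using assms by (simp add: act_mult)
  then show ?thesis using assms by (simp add: act_one flip: const_mult)
qed

lemma scalar_act_inj:
  assumes "m \<in> carrier M" "m \<noteq> \<zero>\<^bsub>M\<^esub>" "const a \<cdot> m = const b \<cdot> m"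
  shows "a = b"
proof (rule ccontr)
  assume "a \<noteq> b"
  moreover have "const (a - b) \<cdot> m = \<zero>\<^bsub>M\<^esub>"
    using assms by (simp add: const_diff act_diff M.minus_eq M.r_neg)
  ultimately show False using scalar_act_eq_zero[of m "a - b"] assms by simp
qed

lemma scalar_act_commute: "m \<in> carrier M \<Longrightarrow> x \<cdot> const c \<cdot> m = const c \<cdot> x \<cdot> m"
  by (simp add: const_commute flip: act_mult)

lemma central_act:
  "central q z \<Longrightarrow> m \<in> carrier M \<Longrightarrow> x \<cdot> (z \<odot>\<^bsub>M\<^esub> m) = z \<odot>\<^bsub>M\<^esub> (x \<cdot> m)"
  unfolding central_def by (metis smult_assoc cls_closed)

subsection \<open>Spans\<close>

sublocale S: left_module "scalars q" M
  by (rule left_module_subring[OF subring_scalars])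

lemma subspace_iff:
  "submodule V (scalars q) M \<longleftrightarrow> V \<subseteq> carrier M \<and> \<zero>\<^bsub>M\<^esub> \<in> V
     \<and> (\<forall>x\<in>V. \<forall>y\<in>V. x \<oplus>\<^bsub>M\<^esub> y \<in> V) \<and> (\<forall>c. \<forall>x\<in>V. const c \<cdot> x \<in> V)"
  by (auto simp: S.submodule_iff)

lemma fin_dim_subspace:
  assumes "submodule V (scalars q) M" "finite S" "S \<subseteq> carrier M"
    "V \<subseteq> submodule_gen (scalars q) M S"
  shows "fin_dim q M V"
proof -
  have "\<exists>d\<in>carrier (scalars q). d \<otimes>\<^bsub>scalars q\<^esub> c = \<one>\<^bsub>scalars q\<^esub>"
    if c: "c \<in> carrier (scalars q)" "c \<noteq> \<zero>\<^bsub>scalars q\<^esub>" for c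
  proof -
    obtain a where a: "c = uscal q a" using c(1) by force
    then have "a \<noteq> 0" using c(2) by (auto simp: cls_zero)
    then have "uscal q (inverse a) \<otimes>\<^bsub>U_gh q\<^esub> c = \<one>\<^bsub>U_gh q\<^esub>"
      by (simp add: a cls_one flip: cls_mult const_mult)
    then show ?thesis by auto
  qed
  then show ?thesis
    using S.division_ring_submodule_finitely_generated[OF _ assms(2,3,1,4)]
    unfolding fin_dim_def by blast
qed

text \<open>
  The cyclic subspace spanned by all \<open>x^n m\<close> is a subspace of \<open>V\<close>, so finitely many
  polynomials in \<open>x\<close> already span it; a power of \<open>x\<close> of higher degree then gives a relation.
\<close>

lemma annihilating_polynomial:
  assumes V: "fin_dim q M V" "V \<subseteq> carrier M" and stable: "\<And>v. v \<in> V \<Longrightarrow> x \<cdot> v \<in> V" and m: "m \<in> V"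
  obtains p where "p \<noteq> 0" "peval x p \<cdot> m = \<zero>\<^bsub>M\<^esub>"
proof -
  obtain S where S: "finite S" "S \<subseteq> V" "V = submodule_gen (scalars q) M S"
    using V(1) unfolding fin_dim_def by blast
  have S': "S \<subseteq> carrier M" using S V by blast
  have Vsub: "submodule V (scalars q) M" using S.submodule_gen_submodule[OF S'] S(3) by simp
  have mc: "m \<in> carrier M" using V m by blast
  define P where "P D = {peval x p \<cdot> m | p. D p}" for D :: "'k poly \<Rightarrow> bool"
  have P: "submodule (P D) (scalars q) M"
    if "D 0" "\<And>p r. D p \<Longrightarrow> D r \<Longrightarrow> D (p + r)" "\<And>c p. D p \<Longrightarrow> D (smult c p)" for D
    unfolding subspace_iff
  proof (intro conjI ballI allI)
    show "P D \<subseteq> carrier M" using mc by (auto simp: P_def)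
    show "\<zero>\<^bsub>M\<^esub> \<in> P D" using that(1) mc by (auto simp: P_def act_zero intro!: exI[of _ 0])
  next
    fix y z assume "y \<in> P D" "z \<in> P D"
    then obtain p r where "D p" "D r" "y = peval x p \<cdot> m" "z = peval x r \<cdot> m"
      by (auto simp: P_def)
    then show "y \<oplus>\<^bsub>M\<^esub> z \<in> P D"
      using that(2) mc by (auto simp: P_def act_add peval_add intro!: exI[of _ "p + r"])
  next
    fix c y assume "y \<in> P D"
    then obtain p where "D p" "y = peval x p \<cdot> m" by (auto simp: P_def)
    then show "const c \<cdot> y \<in> P D"
      using that(3) mc by (auto simp: P_def act_mult peval_smult intro!: exI[of _ "smult c p"])
  qed
  have inV: "peval x p \<cdot> m \<in> V" for p
  proof (induction p)
    case 0
    then show ?case using Vsub mc by (simp add: act_zero subspace_iff)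
  next
    case (pCons a p)
    have "peval x (pCons a p) \<cdot> m = const a \<cdot> m \<oplus>\<^bsub>M\<^esub> x \<cdot> peval x p \<cdot> m"
      using mc by (simp add: peval_pCons act_add act_mult)
    then show ?case using Vsub m stable[OF pCons.IH] by (simp add: subspace_iff)
  qed
  then have "P (\<lambda>_. True) \<subseteq> submodule_gen (scalars q) M S" using S(3) by (auto simp: P_def)
  then have "fin_dim q M (P (\<lambda>_. True))" using fin_dim_subspace[OF P S(1) S'] by simp
  then obtain T where T: "finite T" "T \<subseteq> P (\<lambda>_. True)"
    "P (\<lambda>_. True) = submodule_gen (scalars q) M T"
    unfolding fin_dim_def by blast
  have "\<forall>t\<in>T. \<exists>p. t = peval x p \<cdot> m" using T(2) by (auto simp: P_def)
  then obtain p where p: "\<And>t. t \<in> T \<Longrightarrow> t = peval x (p t) \<cdot> m" by metis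
  \<comment> \<open>\<open>N\<close> exceeds the degrees of all polynomials chosen for the spanning vectors.\<close>
  define N where "N = Suc (\<Sum>t\<in>T. degree (p t))"
  have "degree (p t) < N" if "t \<in> T" for t
    using member_le_sum[of t T "\<lambda>t. degree (p t)"] that T(1) by (simp add: N_def)
  then have TN: "T \<subseteq> P (\<lambda>p. degree p < N)" using p by (force simp: P_def)
  have "submodule (P (\<lambda>p. degree p < N)) (scalars q) M"
    by (rule P) (auto simp: N_def intro: degree_add_less le_less_trans[OF degree_smult_le])
  then have "P (\<lambda>_. True) \<subseteq> P (\<lambda>p. degree p < N)"
    unfolding T(3) by (rule S.submodule_gen_least[OF _ TN])
  moreover have "peval x (Polynomial.monom 1 N) \<cdot> m \<in> P (\<lambda>_. True)" by (auto simp: P_def)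
  ultimately obtain r where r: "degree r < N" "peval x (Polynomial.monom 1 N) \<cdot> m = peval x r \<cdot> m"
    by (auto simp: P_def)
  have "Polynomial.monom 1 N - r \<noteq> 0" using r(1) by (auto simp: Polynomial.degree_monom_eq)
  moreover have "peval x (Polynomial.monom 1 N - r) \<cdot> m = \<zero>\<^bsub>M\<^esub>"
    using r(2) mc by (simp add: peval_diff act_diff M.minus_eq M.r_neg)
  ultimately show ?thesis using that by blast
qed

lemma coprime_polynomials_annihilate:
  assumes "m \<in> carrier M" "peval x p \<cdot> m = \<zero>\<^bsub>M\<^esub>" "peval x r \<cdot> m = \<zero>\<^bsub>M\<^esub>" "u * p + v * r = 1"
  shows "m = \<zero>\<^bsub>M\<^esub>"
proof -
  have "m = peval x (u * p + v * r) \<cdot> m" using assms by (simp add: act_one)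
  also have "\<dots> = \<zero>\<^bsub>M\<^esub>" using assms(1-3) by (simp add: peval_add peval_mult act_add act_mult)
  finally show ?thesis .
qed

lemma distinct_generalized_eigenvalues:
  assumes "m \<in> carrier M" "a \<noteq> b" "z \<in> carrier (U_gh q)"
    "((z \<ominus>\<^bsub>U_gh q\<^esub> uscal q a) [^]\<^bsub>U_gh q\<^esub> (n::nat)) \<odot>\<^bsub>M\<^esub> m = \<zero>\<^bsub>M\<^esub>"
    "((z \<ominus>\<^bsub>U_gh q\<^esub> uscal q b) [^]\<^bsub>U_gh q\<^esub> (k::nat)) \<odot>\<^bsub>M\<^esub> m = \<zero>\<^bsub>M\<^esub>"
  shows "m = \<zero>\<^bsub>M\<^esub>"
proof -
  obtain x where x: "z = cls q x" using assms(3) by (auto simp: carrier_U_gh)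
  have "poly ([:- b, 1:] ^ k) a \<noteq> 0" using assms(2) by simp
  then obtain u v where "u * [:- a, 1:] ^ n + v * [:- b, 1:] ^ k = 1" by (rule linear_power_bezout)
  then show ?thesis
    using assms(4,5) coprime_polynomials_annihilate[OF assms(1)]
    by (simp add: x flip: cls_peval_linear_power)
qed

subsection \<open>Weight spaces\<close>

text \<open>
  The coordinate of a weight belonging to a generator, so that \<open>K\<close>, \<open>g\<close>, \<open>h\<close> can be treated alike.
\<close>

fun weight_entry :: "'k \<times> 'k \<times> 'k \<Rightarrow> gh_gen \<Rightarrow> 'k" where
  "weight_entry (a, b, c) y = (if y = Gen_K then a else if y = Gen_g then b else c)"

lemma weight_space_iff:
  "m \<in> weight_space q M w \<longleftrightarrow>
     m \<in> carrier M \<and> (\<forall>y\<in>{Gen_K, Gen_g, Gen_h}. gen y \<cdot> m = const (weight_entry w y) \<cdot> m)"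
  by (cases w) (simp add: weight_space_def)

lemma weight_space_subspace: "submodule (weight_space q M w) (scalars q) M"
  unfolding subspace_iff weight_space_iff
  by (auto simp: weight_space_iff act_add_right scalar_act_commute[of _ "gen _"] scalar_act_commute[of _ "const _"])

lemma weight_space_carrier: "weight_space q M w \<subseteq> carrier M"
  by (auto simp: weight_space_iff)

text \<open>
  Two weights differ in the eigenvalue of one of \<open>K\<close>, \<open>g\<close>, \<open>h\<close>; subtracting the second eigenvalue
  from that generator kills one weight space and acts by a nonzero scalar on the other.
\<close>

lemma weight_spaces_independent:
  assumes "m \<in> weight_space q M w" "m \<in> subgroup_sum M (UNIV - {w}) (weight_space q M)"
  shows "m = \<zero>\<^bsub>M\<^esub>"
proof (rule separated_subgroups_independent[of UNIV "weight_space q M", OF _ _ UNIV_I assms])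
  show "additive_subgroup (weight_space q M w) M" for w
    using S.submodule_additive[OF weight_space_subspace] .
next
  fix w w' :: "'k \<times> 'k \<times> 'k" and x
  assume "w \<noteq> w'" and x: "x \<in> weight_space q M w'"
  have "\<exists>y\<in>{Gen_K, Gen_g, Gen_h}. weight_entry w y \<noteq> weight_entry w' y"
    using \<open>w \<noteq> w'\<close> by (cases w; cases w') auto
  then obtain y where y: "y \<in> {Gen_K, Gen_g, Gen_h}" "weight_entry w y \<noteq> weight_entry w' y"
    by blast
  define d where "d = gen y - const (weight_entry w' y)"
  have d: "d \<cdot> v = const (weight_entry u y - weight_entry w' y) \<cdot> v"
    if "v \<in> weight_space q M u" for u v
    using that y(1) unfolding weight_space_iff d_def by (auto simp only: act_diff const_diff)
  show "\<exists>a\<in>carrier (U_gh q). a \<odot>\<^bsub>M\<^esub> x = \<zero>\<^bsub>M\<^esub>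
      \<and> (\<forall>k\<in>UNIV. \<forall>y\<in>weight_space q M k. a \<odot>\<^bsub>M\<^esub> y \<in> weight_space q M k)
      \<and> (\<forall>y\<in>weight_space q M w. a \<odot>\<^bsub>M\<^esub> y = \<zero>\<^bsub>M\<^esub> \<longrightarrow> y = \<zero>\<^bsub>M\<^esub>)"
  proof (intro bexI[of _ "cls q d"] conjI ballI impI)
    show "d \<cdot> x = \<zero>\<^bsub>M\<^esub>" using d[OF x] x weight_space_carrier by (simp add: act_zero subset_iff)
  next
    fix u v assume "v \<in> weight_space q M u"
    then show "d \<cdot> v \<in> weight_space q M u"
      using d weight_space_subspace[of u] by (simp add: subspace_iff)
  next
    fix v assume v: "v \<in> weight_space q M w" "d \<cdot> v = \<zero>\<^bsub>M\<^esub>"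
    then show "v = \<zero>\<^bsub>M\<^esub>"
      using d[OF v(1)] y(2) weight_space_carrier[of w]
      by (intro scalar_act_eq_zero[of v "weight_entry w y - weight_entry w' y"]) auto
  qed simp
qed

subsection \<open>Simultaneous eigenspaces of $g$ and $h$\<close>

definition gh_eigenspace :: "'k \<Rightarrow> 'k \<Rightarrow> 'm set" where
  "gh_eigenspace b c = {m \<in> carrier M. gen Gen_g \<cdot> m = const b \<cdot> m \<and> gen Gen_h \<cdot> m = const c \<cdot> m}"

lemma gh_eigenspace_carrier: "m \<in> gh_eigenspace b c \<Longrightarrow> m \<in> carrier M"
  by (simp add: gh_eigenspace_def)

lemma gh_eigenspace_act: "m \<in> gh_eigenspace b c \<Longrightarrow> x \<cdot> m \<in> gh_eigenspace b c"
  using central_act[OF central_gens(1), of m x] central_act[OF central_gens(3), of m x]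
  by (auto simp: gh_eigenspace_def scalar_act_commute)

lemma inverse_act:
  assumes "m \<in> carrier M" "x \<cdot> m = const b \<cdot> m" "vanishes q (x' * x - 1)"
  shows "x' \<cdot> m = const (inverse b) \<cdot> m"
proof -
  have "m = (x' * x) \<cdot> m" using assms(1,3) by (simp add: vanishes_diff_iff act_one)
  then have m: "m = const b \<cdot> x' \<cdot> m" using assms(1,2) by (simp add: act_mult scalar_act_commute)
  show ?thesis
  proof (cases "b = 0")
    case True
    then have "m = \<zero>\<^bsub>M\<^esub>" using m assms(1) by (simp add: act_zero)
    then show ?thesis by simp
  next
    case False
    have "const (inverse b) \<cdot> m = (const (inverse b) * const b) \<cdot> x' \<cdot> m"
      using assms(1) m by (metis act_mult act_closed)
    then show ?thesis using False assms(1) by (simp add: act_one flip: const_mult)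
  qed
qed

text \<open>
  On a simultaneous eigenspace of \<open>g\<close> and \<open>h\<close> the algebra generated by \<open>C\<close> and the
  positive and negative powers of \<open>g\<close> and \<open>h\<close> acts through polynomials in \<open>C\<close> alone. This reduces all
  questions about central characters to one operator.
\<close>

lemma Z_gh_acts_by_casimir_polynomial:
  assumes C: "casimir q = cls q C" and "z \<in> Z_gh q"
  shows "\<exists>p. \<forall>m\<in>gh_eigenspace b c. z \<odot>\<^bsub>M\<^esub> m = peval C p \<cdot> m"
  using assms(2) unfolding Z_gh_def subalg_def
proof induction
  case one
  show ?case
    using gh_eigenspace_carrier by (intro exI[of _ 1]) (auto simp: act_one smult_one)
next
  case (incl z)
  then consider a where "z = uscal q a" | "z = casimir q" | "z = ugen q Gen_g" | "z = ugen q Gen_h"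
    | "z = ugen q Gen_g_inv" | "z = ugen q Gen_h_inv" by auto
  then have "\<exists>p. \<forall>m\<in>gh_eigenspace b c. z \<odot>\<^bsub>M\<^esub> m = peval C p \<cdot> m"
  proof cases
    case (1 a)
    then show ?thesis by (intro exI[of _ "[:a:]"]) (simp add: peval_pCons)
  next
    case 2
    then show ?thesis by (intro exI[of _ "[:0, 1:]"]) (simp add: peval_pCons C)
  next
    case 3
    then show ?thesis
      by (intro exI[of _ "[:b:]"]) (simp add: peval_pCons gh_eigenspace_def)
  next
    case 4
    then show ?thesis
      by (intro exI[of _ "[:c:]"]) (simp add: peval_pCons gh_eigenspace_def)
  next
    case 5
    then show ?thesis
      using inverse_act[OF _ _ relations_vanish(4)]
      by (intro exI[of _ "[:inverse b:]"]) (simp add: peval_pCons gh_eigenspace_def)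
  next
    case 6
    then show ?thesis
      using inverse_act[OF _ _ relations_vanish(6)]
      by (intro exI[of _ "[:inverse c:]"]) (simp add: peval_pCons gh_eigenspace_def)
  qed
  then show ?case .
next
  case (a_inv z)
  then obtain p where p: "\<forall>m\<in>gh_eigenspace b c. z \<odot>\<^bsub>M\<^esub> m = peval C p \<cdot> m" by blast
  have z: "z \<in> carrier (U_gh q)" using a_inv Z_gh_carrier unfolding Z_gh_def subalg_def by blast
  have "(\<ominus>\<^bsub>U_gh q\<^esub> z) \<odot>\<^bsub>M\<^esub> m = peval C (- p) \<cdot> m" if "m \<in> gh_eigenspace b c" for m
    using that p z gh_eigenspace_carrier[OF that]
    by (simp add: peval_minus cls_minus smult_l_minus)
  then show ?case by blast
next
  case (eng_add z z')
  then obtain p p' where p: "\<forall>m\<in>gh_eigenspace b c. z \<odot>\<^bsub>M\<^esub> m = peval C p \<cdot> m"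
    "\<forall>m\<in>gh_eigenspace b c. z' \<odot>\<^bsub>M\<^esub> m = peval C p' \<cdot> m" by blast
  have z: "z \<in> carrier (U_gh q)" "z' \<in> carrier (U_gh q)"
    using eng_add Z_gh_carrier unfolding Z_gh_def subalg_def by blast+
  have "(z \<oplus>\<^bsub>U_gh q\<^esub> z') \<odot>\<^bsub>M\<^esub> m = peval C (p + p') \<cdot> m" if "m \<in> gh_eigenspace b c" for m
    using that p z gh_eigenspace_carrier[OF that] by (simp add: peval_add act_add smult_l_distr)
  then show ?case by blast
next
  case (eng_mult z z')
  then obtain p p' where p: "\<forall>m\<in>gh_eigenspace b c. z \<odot>\<^bsub>M\<^esub> m = peval C p \<cdot> m"
    "\<forall>m\<in>gh_eigenspace b c. z' \<odot>\<^bsub>M\<^esub> m = peval C p' \<cdot> m" by blast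
  have z: "z \<in> carrier (U_gh q)" "z' \<in> carrier (U_gh q)"
    using eng_mult Z_gh_carrier unfolding Z_gh_def subalg_def by blast+
  have "(z \<otimes>\<^bsub>U_gh q\<^esub> z') \<odot>\<^bsub>M\<^esub> m = peval C (p * p') \<cdot> m" if "m \<in> gh_eigenspace b c" for m
    using that p z gh_eigenspace_carrier[OF that] gh_eigenspace_act[OF that]
    by (simp add: peval_mult act_mult smult_assoc)
  then show ?case by blast
qed

text \<open>
  A generalized eigenvector of \<open>C\<close> in a simultaneous eigenspace of \<open>g\<close> and \<open>h\<close> yields a
  genuine eigenvector \<open>v\<close>; the character is read off from the scalars by which the central
  subalgebra acts on \<open>v\<close>.
\<close>

lemma generalized_eigenvector_in_primary_component:
  assumes C: "casimir q = cls q C" and m: "m \<in> gh_eigenspace b c" "m \<noteq> \<zero>\<^bsub>M\<^esub>"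
    and n: "peval C ([:- a, 1:] ^ n) \<cdot> m = \<zero>\<^bsub>M\<^esub>"
  shows "\<exists>\<nu>\<in>central_chars q. m \<in> primary_component q M \<nu>"
proof -
  let ?l = "[:- a, 1:]"
  have mc: "m \<in> carrier M" using m gh_eigenspace_carrier by blast
  \<comment> \<open>The last nonzero vector in the sequence \<open>m\<close>, \<open>(C - a) m\<close>, ... is the eigenvector \<open>v\<close>.\<close>
  obtain k where k: "peval C (?l ^ Suc k) \<cdot> m = \<zero>\<^bsub>M\<^esub>" "peval C (?l ^ k) \<cdot> m \<noteq> \<zero>\<^bsub>M\<^esub>"
  proof -
    define k where "k = (LEAST n. peval C (?l ^ n) \<cdot> m = \<zero>\<^bsub>M\<^esub>)"
    have k0: "peval C (?l ^ k) \<cdot> m = \<zero>\<^bsub>M\<^esub>" using LeastI[of "\<lambda>n. peval C (?l ^ n) \<cdot> m = \<zero>\<^bsub>M\<^esub>" n] n unfolding k_def by simp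
    then have "k \<noteq> 0" using m(2) mc by (auto simp: act_one simp flip: one_pCons intro: ccontr)
    then obtain j where j: "k = Suc j" using not0_implies_Suc by blast
    moreover have "peval C (?l ^ j) \<cdot> m \<noteq> \<zero>\<^bsub>M\<^esub>"
      using not_less_Least[of j "\<lambda>n. peval C (?l ^ n) \<cdot> m = \<zero>\<^bsub>M\<^esub>"] j unfolding k_def by auto
    ultimately show ?thesis using that k0 by blast
  qed
  define v where "v = peval C (?l ^ k) \<cdot> m"
  have v: "v \<in> gh_eigenspace b c" "v \<in> carrier M" "v \<noteq> \<zero>\<^bsub>M\<^esub>"
    using k(2) gh_eigenspace_act[OF m(1)] gh_eigenspace_carrier by (auto simp: v_def)
  have lv: "peval C ?l \<cdot> v = \<zero>\<^bsub>M\<^esub>"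
    using k(1) mc by (simp only: v_def power_Suc peval_mult act_mult)
  have split: "p = ?l * synthetic_div p a + [:poly p a:]" for p :: "'k poly"
    by (rule synthetic_div_correct'[symmetric])
  have eval: "peval C p \<cdot> v = const (poly p a) \<cdot> v" for p
  proof -
    have "peval C p \<cdot> v = peval C (synthetic_div p a * ?l + [:poly p a:]) \<cdot> v"
      using split[of p] by (simp only: mult.commute)
    also have "\<dots> = peval C (synthetic_div p a) \<cdot> peval C ?l \<cdot> v \<oplus>\<^bsub>M\<^esub> const (poly p a) \<cdot> v"
      using v(2) by (simp only: peval_add peval_mult act_add act_mult act_closed)
        (simp add: peval_pCons)
    finally show ?thesis using v(2) lv by simp
  qed
  have "\<forall>z\<in>Z_gh q. \<exists>p. \<forall>m\<in>gh_eigenspace b c. z \<odot>\<^bsub>M\<^esub> m = peval C p \<cdot> m"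
    using Z_gh_acts_by_casimir_polynomial[OF C] by blast
  then obtain P where P: "\<And>z m. z \<in> Z_gh q \<Longrightarrow> m \<in> gh_eigenspace b c \<Longrightarrow> z \<odot>\<^bsub>M\<^esub> m = peval C (P z) \<cdot> m"
    by metis
  define \<nu> where "\<nu> = restrict (\<lambda>z. poly (P z) a) (Z_gh q)"
  have zv: "z \<odot>\<^bsub>M\<^esub> v = const (\<nu> z) \<cdot> v" if "z \<in> Z_gh q" for z
    using P[OF that v(1)] eval that by (simp add: \<nu>_def)
  have uniq: "\<nu> z = s" if "z \<in> Z_gh q" "z \<odot>\<^bsub>M\<^esub> v = const s \<cdot> v" for z s
    using zv[OF that(1)] that(2) scalar_act_inj[OF v(2,3)] by metis
  note Z = Z_gh_closed[where q = q]
  have "\<nu> \<in> ring_hom ((U_gh q)\<lparr>carrier := Z_gh q\<rparr>) ring_of_type_algebra"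
  proof (rule ring_hom_memI)
    fix y z assume "y \<in> carrier ((U_gh q)\<lparr>carrier := Z_gh q\<rparr>)" "z \<in> carrier ((U_gh q)\<lparr>carrier := Z_gh q\<rparr>)"
    then have yz: "y \<in> Z_gh q" "z \<in> Z_gh q" by auto
    then have carr: "y \<in> carrier (U_gh q)" "z \<in> carrier (U_gh q)" using Z_gh_carrier by auto
    obtain x where x: "y = cls q x" using carr(1) by (auto simp: carrier_U_gh)
    have "(y \<otimes>\<^bsub>U_gh q\<^esub> z) \<odot>\<^bsub>M\<^esub> v = x \<cdot> const (\<nu> z) \<cdot> v"
      using carr v(2) zv[OF yz(2)] by (simp add: smult_assoc x)
    also have "\<dots> = const (\<nu> z) \<cdot> const (\<nu> y) \<cdot> v"
      using zv[OF yz(1)] by (simp only: scalar_act_commute[OF v(2), of x] x)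
    also have "\<dots> = const (\<nu> y * \<nu> z) \<cdot> v"
      using v(2) by (simp only: mult.commute[of "\<nu> y"] const_mult act_mult)
    finally have "(y \<otimes>\<^bsub>U_gh q\<^esub> z) \<odot>\<^bsub>M\<^esub> v = const (\<nu> y * \<nu> z) \<cdot> v" .
    then show "\<nu> (y \<otimes>\<^bsub>(U_gh q)\<lparr>carrier := Z_gh q\<rparr>\<^esub> z) = \<nu> y \<otimes>\<^bsub>ring_of_type_algebra\<^esub> \<nu> z"
      using uniq[OF Z(4)[OF yz]] by simp
    have "(y \<oplus>\<^bsub>U_gh q\<^esub> z) \<odot>\<^bsub>M\<^esub> v = const (\<nu> y + \<nu> z) \<cdot> v"
      using carr v(2) zv[OF yz(1)] zv[OF yz(2)] by (simp add: smult_l_distr const_add act_add)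
    then show "\<nu> (y \<oplus>\<^bsub>(U_gh q)\<lparr>carrier := Z_gh q\<rparr>\<^esub> z) = \<nu> y \<oplus>\<^bsub>ring_of_type_algebra\<^esub> \<nu> z"
      using uniq[OF Z(3)[OF yz]] by simp
  next
    show "\<nu> \<one>\<^bsub>(U_gh q)\<lparr>carrier := Z_gh q\<rparr>\<^esub> = \<one>\<^bsub>ring_of_type_algebra\<^esub>"
      using uniq[OF Z(1), of 1] by (simp add: cls_one)
  qed simp
  moreover have "\<forall>s. \<nu> (uscal q s) = s" using uniq[OF Z(2)] by blast
  ultimately have "\<nu> \<in> central_chars q" by (simp add: central_chars_def \<nu>_def)
  moreover have "m \<in> primary_component q M \<nu>"
  proof -
    have "((z \<ominus>\<^bsub>U_gh q\<^esub> uscal q (\<nu> z)) [^]\<^bsub>U_gh q\<^esub> n) \<odot>\<^bsub>M\<^esub> m = \<zero>\<^bsub>M\<^esub>" if z: "z \<in> Z_gh q" for z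
    proof -
      \<comment> \<open>\<open>z - \<nu> z\<close> acts as a multiple of \<open>C - a\<close>, so its \<open>n\<close>-th power kills \<open>m\<close> too.\<close>
      let ?r = "synthetic_div (P z) a"
      obtain x where x: "z = cls q x" using Z_gh_carrier z by (auto simp: carrier_U_gh)
      let ?d = "x - const (\<nu> z)"
      have d: "?d \<cdot> u = peval C (?r * ?l) \<cdot> u" if u: "u \<in> gh_eigenspace b c" for u
      proof -
        have "?r * ?l = P z - [:\<nu> z:]" using split[of "P z"] z by (simp only: \<nu>_def restrict_apply' mult.commute[of ?r] add_diff_cancel_right' eq_diff_eq)
        then show ?thesis
          using P[OF z u] gh_eigenspace_carrier[OF u]
          by (simp add: x peval_diff peval_pCons act_diff)
      qed
      have "?d ^ j \<cdot> m = peval C ((?r * ?l) ^ j) \<cdot> m" for j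
      proof (induction j)
        case (Suc j)
        then show ?case
          using mc d[OF gh_eigenspace_act[OF m(1)]] by (simp only: power_Suc peval_mult act_mult act_closed)
      qed simp
      then have "?d ^ n \<cdot> m = peval C (?r ^ n) \<cdot> peval C (?l ^ n) \<cdot> m"
        using mc by (simp only: power_mult_distrib peval_mult act_mult)
      then show ?thesis using n by (simp add: x cls_diff cls_power)
    qed
    then show ?thesis using mc unfolding primary_component_def by blast
  qed
  ultimately show ?thesis by blast
qed

end

section \<open>Closure of category O under sums of homomorphic images\<close>

lemma left_module_hom_weight_space:
  assumes L: "left_module (U_gh q) L" and M: "left_module (U_gh q) M"
    and f: "f \<in> left_module_hom (U_gh q) L M" and m: "m \<in> weight_space q L w"
  shows "f m \<in> weight_space q M w"
proof -
  have *: "f (cls q x \<odot>\<^bsub>L\<^esub> m) = cls q x \<odot>\<^bsub>M\<^esub> f m" for x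
    using left_module_hom_smult[OF L M f] m by (cases w) (simp add: weight_space_def)
  show ?thesis
    using m left_module_hom_closed[OF L M f, of m] *
    by (cases w) (simp add: weight_space_def flip: *)
qed

lemma (in U_module) B_plus_orbit_subspace:
  assumes "m \<in> carrier M"
  shows "submodule ((\<lambda>b. b \<odot>\<^bsub>M\<^esub> m) ` B_plus q) (scalars q) M"
  unfolding subspace_iff
proof (intro conjI ballI allI)
  have B: "\<And>b. b \<in> B_plus q \<Longrightarrow> b \<in> carrier (U_gh q)" using B_plus_closed(1) by blast
  show "(\<lambda>b. b \<odot>\<^bsub>M\<^esub> m) ` B_plus q \<subseteq> carrier M" using B assms smult_closed by blast
  show "\<zero>\<^bsub>M\<^esub> \<in> (\<lambda>b. b \<odot>\<^bsub>M\<^esub> m) ` B_plus q"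
    using B_plus_closed(2) smult_l_zero[OF assms] by (metis imageI)
  fix x assume "x \<in> (\<lambda>b. b \<odot>\<^bsub>M\<^esub> m) ` B_plus q"
  then obtain b where b: "b \<in> B_plus q" "x = b \<odot>\<^bsub>M\<^esub> m" by blast
  show "const c \<cdot> x \<in> (\<lambda>b. b \<odot>\<^bsub>M\<^esub> m) ` B_plus q" for c
  proof -
    have "const c \<cdot> x = (uscal q c \<otimes>\<^bsub>U_gh q\<^esub> b) \<odot>\<^bsub>M\<^esub> m"
      using b B assms by (simp add: smult_assoc)
    then show ?thesis using B_plus_closed(5)[OF B_plus_closed(3) b(1)] by blast
  qed
  fix y assume "y \<in> (\<lambda>b. b \<odot>\<^bsub>M\<^esub> m) ` B_plus q"
  then obtain b' where b': "b' \<in> B_plus q" "y = b' \<odot>\<^bsub>M\<^esub> m" by blast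
  have "x \<oplus>\<^bsub>M\<^esub> y = (b \<oplus>\<^bsub>U_gh q\<^esub> b') \<odot>\<^bsub>M\<^esub> m"
    using b b' B assms by (simp add: smult_l_distr)
  then show "x \<oplus>\<^bsub>M\<^esub> y \<in> (\<lambda>b. b \<odot>\<^bsub>M\<^esub> m) ` B_plus q" using B_plus_closed(4) b b' by blast
qed

text \<open>
  Generators, weight vectors and finite spanning sets are all carried along by homomorphisms.
  The images of the weight spaces of the \<open>L i\<close> lie in the weight spaces of \<open>M\<close> and together
  generate \<open>M\<close>, so by independence of weights they exhaust the weight spaces of \<open>M\<close>. The orbit of
  \<open>m\<close> under \<open>B_plus\<close> lies in a sum of finite-dimensional orbits, and a subspace of a
  finite-dimensional space is finite-dimensional.
\<close>

lemma cat_O_sum_of_hom_images: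
  fixes L :: "'i \<Rightarrow> ('k::field free_gh set, 'm) module" and M :: "('k free_gh set, 'n) module"
  assumes M: "left_module (U_gh q) M" and T: "finite T"
    and L: "\<And>i. i \<in> T \<Longrightarrow> L i \<in> cat_O q"
    and f: "\<And>i. i \<in> T \<Longrightarrow> f i \<in> left_module_hom (U_gh q) (L i) M"
    and gen: "carrier M \<subseteq> subgroup_sum M T (\<lambda>i. f i ` carrier (L i))"
  shows "M \<in> cat_O q"
proof -
  interpret U_module q M using M by (simp add: U_module_def)
  have LM: "left_module (U_gh q) (L i)" if "i \<in> T" for i using L[OF that] by (simp add: cat_O_def)
  have fs: "f i \<in> left_module_hom (scalars q) (L i) M" if "i \<in> T" for i
    by (rule left_module_hom_subring[OF subring_scalars f[OF that]])
  have LS: "left_module (scalars q) (L i)" if "i \<in> T" for i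
    using left_module.left_module_subring[OF LM[OF that] subring_scalars] .
  have img_carrier: "f i ` carrier (L i) \<subseteq> carrier M" if "i \<in> T" for i
    using left_module_hom_closed[OF LM[OF that] M f[OF that]] by blast

  have fg: "finitely_generated (U_gh q) M"
  proof -
    have "\<forall>i\<in>T. \<exists>S. finite S \<and> S \<subseteq> carrier (L i) \<and> carrier (L i) = submodule_gen (U_gh q) (L i) S"
      using L by (simp add: cat_O_def finitely_generated_def)
    then obtain S where S: "\<And>i. i \<in> T \<Longrightarrow> finite (S i)" "\<And>i. i \<in> T \<Longrightarrow> S i \<subseteq> carrier (L i)"
      "\<And>i. i \<in> T \<Longrightarrow> carrier (L i) = submodule_gen (U_gh q) (L i) (S i)" by metis
    define G where "G = (\<Union>i\<in>T. f i ` S i)"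
    have "f i ` S i \<subseteq> carrier M" if "i \<in> T" for i
      using image_mono[OF S(2)[OF that]] img_carrier[OF that] by (rule subset_trans)
    then have G: "finite G" "G \<subseteq> carrier M"
      using T S(1) by (simp_all add: G_def UN_subset_iff)
    have sub: "submodule (submodule_gen (U_gh q) M G) (U_gh q) M"
      by (rule submodule_gen_submodule[OF G(2)])
    have "f i ` carrier (L i) \<subseteq> submodule_gen (U_gh q) M G" if i: "i \<in> T" for i
    proof -
      have "f i ` carrier (L i) \<subseteq> submodule_gen (U_gh q) M (f i ` S i)"
        using left_module_hom_submodule_gen[OF LM[OF i] M f[OF i] S(2)[OF i]] S(3)[OF i] by simp
      also have "\<dots> \<subseteq> submodule_gen (U_gh q) M G"
        using i by (intro submodule_gen_mono) (auto simp: G_def)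
      finally show ?thesis .
    qed
    then have "carrier M \<subseteq> submodule_gen (U_gh q) M G"
      by (intro subset_trans[OF gen M.subgroup_sum_least[OF submodule_additive[OF sub]]])
    moreover have "submodule_gen (U_gh q) M G \<subseteq> carrier M" using sub by (simp add: submodule_iff)
    ultimately show ?thesis using G unfolding finitely_generated_def by blast
  qed

  have "\<forall>i\<in>T. \<forall>w. \<exists>S. finite S \<and> S \<subseteq> weight_space q (L i) w
      \<and> weight_space q (L i) w = submodule_gen (scalars q) (L i) S"
    using L by (simp add: cat_O_def fin_dim_def)
  then have "\<exists>S. \<forall>i\<in>T. \<forall>w. finite (S i w) \<and> S i w \<subseteq> weight_space q (L i) w
      \<and> weight_space q (L i) w = submodule_gen (scalars q) (L i) (S i w)" by metis
  then obtain S where S: "\<And>i w. i \<in> T \<Longrightarrow> finite (S i w)"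
    "\<And>i w. i \<in> T \<Longrightarrow> S i w \<subseteq> weight_space q (L i) w"
    "\<And>i w. i \<in> T \<Longrightarrow> weight_space q (L i) w = submodule_gen (scalars q) (L i) (S i w)" by blast
  \<comment> \<open>\<open>Y w\<close> is the part of the weight space \<open>w\<close> of \<open>M\<close> that comes from the modules \<open>L i\<close>.\<close>
  define A where "A w = (\<Union>i\<in>T. f i ` S i w)" for w
  define Y where "Y w = submodule_gen (scalars q) M (A w)" for w
  have A: "finite (A w)" "A w \<subseteq> weight_space q M w" for w
  proof -
    have "f i ` S i w \<subseteq> weight_space q M w" if "i \<in> T" for i
      using S(2)[OF that, of w] left_module_hom_weight_space[OF LM[OF that] M f[OF that]]
      by (blast dest: subsetD)
    then show "finite (A w)" "A w \<subseteq> weight_space q M w"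
      using T S(1) by (simp_all add: A_def UN_subset_iff)
  qed
  then have A_carrier: "A w \<subseteq> carrier M" for w using weight_space_carrier by blast
  have Y_sub: "submodule (Y w) (scalars q) M" for w
    unfolding Y_def by (rule S.submodule_gen_submodule[OF A_carrier])
  have Y_weight: "Y w \<subseteq> weight_space q M w" for w
    unfolding Y_def using A(2) by (intro S.submodule_gen_least weight_space_subspace)
  have Y_add: "additive_subgroup (Y w) M" for w using S.submodule_additive[OF Y_sub] .
  have "f i ` carrier (L i) \<subseteq> subgroup_sum M UNIV Y" if i: "i \<in> T" for i
  proof
    fix y assume "y \<in> f i ` carrier (L i)"
    then obtain x where x: "x \<in> carrier (L i)" "y = f i x" by blast
    interpret Li: U_module q "L i" using LM[OF i] by (simp add: U_module_def)
    have "is_direct_sum (L i) UNIV (weight_space q (L i))" using L[OF i] by (simp add: cat_O_def)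
    then have "x \<in> subgroup_sum (L i) {w\<in>UNIV. weight_space q (L i) w \<noteq> {\<zero>\<^bsub>L i\<^esub>}} (weight_space q (L i))"
      using is_direct_sum_generates[OF Li.M.abelian_group_axioms] x(1) by blast
    then have fx: "f i x \<in> subgroup_sum M {w\<in>UNIV. weight_space q (L i) w \<noteq> {\<zero>\<^bsub>L i\<^esub>}}
        (\<lambda>w. f i ` weight_space q (L i) w)"
      by (rule left_module_hom_subgroup_sum[OF LM[OF i] M f[OF i] Li.weight_space_carrier])
    have "f i ` weight_space q (L i) w \<subseteq> Y w" for w
    proof -
      have "S i w \<subseteq> carrier (L i)" using S(2)[OF i] Li.weight_space_carrier by blast
      from left_module_hom_submodule_gen[OF LS[OF i] S.left_module_axioms fs[OF i] this]
      have "f i ` weight_space q (L i) w \<subseteq> submodule_gen (scalars q) M (f i ` S i w)"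
        using S(3)[OF i, of w] by simp
      also have "\<dots> \<subseteq> Y w" unfolding Y_def A_def using i by (intro S.submodule_gen_mono) blast
      finally show ?thesis .
    qed
    then show "y \<in> subgroup_sum M UNIV Y"
      unfolding x(2) by (intro M.subgroup_sum_mono[OF fx]) simp_all
  qed
  then have Y_gen: "carrier M \<subseteq> subgroup_sum M UNIV Y"
    by (intro subset_trans[OF gen M.subgroup_sum_least
          [OF M.subgroup_sum_additive_subgroup[of UNIV Y, OF Y_add]]])
  have weight_Y: "weight_space q M w = Y w" for w
  proof
    show "weight_space q M w \<subseteq> Y w"
    proof
      fix m assume m: "m \<in> weight_space q M w"
      then have "m \<in> subgroup_sum M UNIV Y" using Y_gen weight_space_carrier by blast
      then obtain y r where yr: "y \<in> Y w" "r \<in> subgroup_sum M (UNIV - {w}) Y" "m = y \<oplus>\<^bsub>M\<^esub> r"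
        using M.subgroup_sum_split[of UNIV Y w m, OF Y_add] by blast
      have r: "r \<in> subgroup_sum M (UNIV - {w}) (weight_space q M)"
        using M.subgroup_sum_mono[OF yr(2) subset_refl] Y_weight by blast
      have carr: "y \<in> carrier M" "r \<in> carrier M"
        using yr(1) Y_weight[of w] weight_space_carrier[of w]
          M.subgroup_sum_closed[OF weight_space_carrier r] by auto
      have "r = m \<ominus>\<^bsub>M\<^esub> y"
        unfolding yr(3) using carr by (simp add: M.minus_eq M.a_comm[of y] M.a_assoc M.r_neg)
      also have "\<dots> \<in> weight_space q M w"
        using S.submodule_diff[OF weight_space_subspace m] yr(1) Y_weight by blast
      finally have "r = \<zero>\<^bsub>M\<^esub>" using weight_spaces_independent[OF _ r] by blast
      then show "m \<in> Y w" using yr carr by simp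
    qed
  qed (rule Y_weight)
  have "is_direct_sum M UNIV (weight_space q M)"
  proof (rule is_direct_sumI[OF M.abelian_group_axioms])
    show "additive_subgroup (weight_space q M w) M" for w
      using S.submodule_additive[OF weight_space_subspace] .
    have "weight_space q M = Y" using weight_Y by (rule ext)
    then show "carrier M \<subseteq> subgroup_sum M UNIV (weight_space q M)" using Y_gen by simp
  qed (rule weight_spaces_independent)
  moreover have "fin_dim q M (weight_space q M w)" for w
    unfolding fin_dim_def using A[of w] weight_Y[of w] unfolding Y_def by blast

  moreover have "fin_dim q M ((\<lambda>b. b \<odot>\<^bsub>M\<^esub> m) ` B_plus q)" if m: "m \<in> carrier M" for m
  proof -
    let ?span = "submodule_gen (scalars q) M"
    \<comment> \<open>The vectors with finite-dimensional orbit, phrased by inclusion to be visibly closed under sums.\<close>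
    define LF where "LF = {m \<in> carrier M. \<exists>S. finite S \<and> S \<subseteq> carrier M
      \<and> (\<forall>b\<in>B_plus q. b \<odot>\<^bsub>M\<^esub> m \<in> ?span S)}"
    have B: "\<And>b. b \<in> B_plus q \<Longrightarrow> b \<in> carrier (U_gh q)" using B_plus_closed(1) by blast
    have "submodule LF (scalars q) M"
      unfolding subspace_iff
    proof (intro conjI ballI allI)
      show "LF \<subseteq> carrier M" by (auto simp: LF_def)
      have "\<zero>\<^bsub>M\<^esub> \<in> ?span {}" using S.submodule_gen_submodule[of "{}"] by (simp add: subspace_iff)
      then show "\<zero>\<^bsub>M\<^esub> \<in> LF"
        using B by (auto simp: LF_def smult_r_zero intro!: exI[of _ "{}"])
    next
      fix x y assume "x \<in> LF" "y \<in> LF"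
      then obtain S S' where *: "x \<in> carrier M" "y \<in> carrier M" "finite S" "finite S'"
        "S \<subseteq> carrier M" "S' \<subseteq> carrier M" "\<forall>b\<in>B_plus q. b \<odot>\<^bsub>M\<^esub> x \<in> ?span S"
        "\<forall>b\<in>B_plus q. b \<odot>\<^bsub>M\<^esub> y \<in> ?span S'" unfolding LF_def by blast
      have span: "submodule (?span (S \<union> S')) (scalars q) M"
        using * by (intro S.submodule_gen_submodule) auto
      have "b \<odot>\<^bsub>M\<^esub> (x \<oplus>\<^bsub>M\<^esub> y) \<in> ?span (S \<union> S')" if b: "b \<in> B_plus q" for b
      proof -
        have "b \<odot>\<^bsub>M\<^esub> x \<in> ?span (S \<union> S')" "b \<odot>\<^bsub>M\<^esub> y \<in> ?span (S \<union> S')"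
          using *(7,8) b S.submodule_gen_mono[of S "S \<union> S'"] S.submodule_gen_mono[of S' "S \<union> S'"] by auto
        then show ?thesis using span B[OF b] * by (simp add: smult_r_distr subspace_iff)
      qed
      then show "x \<oplus>\<^bsub>M\<^esub> y \<in> LF"
        using * unfolding LF_def by (auto intro!: exI[of _ "S \<union> S'"])
    next
      fix c x assume "x \<in> LF"
      then obtain S where *: "x \<in> carrier M" "finite S" "S \<subseteq> carrier M"
        "\<forall>b\<in>B_plus q. b \<odot>\<^bsub>M\<^esub> x \<in> ?span S" unfolding LF_def by blast
      have "b \<odot>\<^bsub>M\<^esub> (const c \<cdot> x) = (b \<otimes>\<^bsub>U_gh q\<^esub> uscal q c) \<odot>\<^bsub>M\<^esub> x" if "b \<in> B_plus q" for b
        using B[OF that] * by (simp add: smult_assoc)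
      then have "b \<odot>\<^bsub>M\<^esub> (const c \<cdot> x) \<in> ?span S" if "b \<in> B_plus q" for b
        using that *(4) B_plus_closed(5)[OF that B_plus_closed(3)] by simp
      then show "const c \<cdot> x \<in> LF" using * unfolding LF_def by auto
    qed
    moreover have "f i ` carrier (L i) \<subseteq> LF" if i: "i \<in> T" for i
    proof
      fix y assume "y \<in> f i ` carrier (L i)"
      then obtain x where x: "x \<in> carrier (L i)" "y = f i x" by blast
      interpret Li: U_module q "L i" using LM[OF i] by (simp add: U_module_def)
      have "fin_dim q (L i) ((\<lambda>b. b \<odot>\<^bsub>L i\<^esub> x) ` B_plus q)"
        using L[OF i] x(1) by (simp add: cat_O_def)
      then obtain S where S: "finite S" "S \<subseteq> (\<lambda>b. b \<odot>\<^bsub>L i\<^esub> x) ` B_plus q"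
        "(\<lambda>b. b \<odot>\<^bsub>L i\<^esub> x) ` B_plus q = submodule_gen (scalars q) (L i) S"
        unfolding fin_dim_def by blast
      have SL: "S \<subseteq> carrier (L i)" using S(2) x(1) B Li.smult_closed by blast
      have "b \<odot>\<^bsub>M\<^esub> y \<in> ?span (f i ` S)" if b: "b \<in> B_plus q" for b
      proof -
        have "b \<odot>\<^bsub>M\<^esub> y = f i (b \<odot>\<^bsub>L i\<^esub> x)"
          using left_module_hom_smult[OF LM[OF i] M f[OF i] B[OF b] x(1)] x(2) by simp
        also have "\<dots> \<in> f i ` submodule_gen (scalars q) (L i) S" using S(3) b by blast
        finally show ?thesis
          using left_module_hom_submodule_gen[OF LS[OF i] S.left_module_axioms fs[OF i] SL] by blast
      qed
      moreover have "finite (f i ` S)" "f i ` S \<subseteq> carrier M" "y \<in> carrier M"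
        using S(1) SL img_carrier[OF i] x by auto
      ultimately show "y \<in> LF" unfolding LF_def by blast
    qed
    ultimately have "carrier M \<subseteq> LF"
      by (intro subset_trans[OF gen M.subgroup_sum_least[OF S.submodule_additive]])
    then obtain S where "finite S" "S \<subseteq> carrier M" "\<forall>b\<in>B_plus q. b \<odot>\<^bsub>M\<^esub> m \<in> ?span S"
      using m unfolding LF_def by blast
    then show ?thesis
      by (intro fin_dim_subspace[OF B_plus_orbit_subspace[OF m]]) auto
  qed
  ultimately show ?thesis using M fg by (simp add: cat_O_def)
qed

section \<open>The primary decomposition\<close>

text \<open>
  The conditions on \<open>q\<close> make \<open>C\<close> central.
\<close>

locale casimir_U_module = U_module q M
  for q :: "'k::alg_closed_field" and M :: "('k free_gh set, 'm) module" +
  assumes q_nonzero: "q \<noteq> 0" and q_square: "q\<^sup>2 \<noteq> 1"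
begin

lemma primary_component_submodule: "submodule (primary_component q M \<nu>) (U_gh q) M"
  unfolding submodule_iff
proof (intro conjI ballI)
  let ?d = "\<lambda>z n. (z \<ominus>\<^bsub>U_gh q\<^esub> uscal q (\<nu> z)) [^]\<^bsub>U_gh q\<^esub> (n::nat)"
  have d: "?d z n \<in> carrier (U_gh q)" "central q (?d z n)" if "z \<in> Z_gh q" for z n
    using Z_gh_power_diff[OF that] Z_gh_carrier Z_gh_central[OF q_nonzero q_square] by auto
  show "primary_component q M \<nu> \<subseteq> carrier M" by (auto simp: primary_component_def)
  show "\<zero>\<^bsub>M\<^esub> \<in> primary_component q M \<nu>"
    using d(1) by (auto simp: primary_component_def smult_r_zero)
  {
    fix x y assume "x \<in> primary_component q M \<nu>" "y \<in> primary_component q M \<nu>"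
    then have x: "x \<in> carrier M" "\<And>z. z \<in> Z_gh q \<Longrightarrow> \<exists>n. ?d z n \<odot>\<^bsub>M\<^esub> x = \<zero>\<^bsub>M\<^esub>"
      and y: "y \<in> carrier M" "\<And>z. z \<in> Z_gh q \<Longrightarrow> \<exists>n. ?d z n \<odot>\<^bsub>M\<^esub> y = \<zero>\<^bsub>M\<^esub>"
      by (auto simp: primary_component_def)
    have "\<exists>n. ?d z n \<odot>\<^bsub>M\<^esub> (x \<oplus>\<^bsub>M\<^esub> y) = \<zero>\<^bsub>M\<^esub>" if z: "z \<in> Z_gh q" for z
    proof -
      obtain n k where nk: "?d z n \<odot>\<^bsub>M\<^esub> x = \<zero>\<^bsub>M\<^esub>" "?d z k \<odot>\<^bsub>M\<^esub> y = \<zero>\<^bsub>M\<^esub>"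
        using x(2)[OF z] y(2)[OF z] by blast
      have D: "z \<ominus>\<^bsub>U_gh q\<^esub> uscal q (\<nu> z) \<in> carrier (U_gh q)"
        using z Z_gh_carrier by (auto intro!: R.minus_closed)
      have "?d z (n + k) \<odot>\<^bsub>M\<^esub> x = ?d z k \<odot>\<^bsub>M\<^esub> (?d z n \<odot>\<^bsub>M\<^esub> x)"
        using d[OF z] x(1) R.nat_pow_mult[OF D, of k n] by (simp add: add.commute flip: smult_assoc)
      moreover have "?d z (n + k) \<odot>\<^bsub>M\<^esub> y = ?d z n \<odot>\<^bsub>M\<^esub> (?d z k \<odot>\<^bsub>M\<^esub> y)"
        using d[OF z] y(1) R.nat_pow_mult[OF D, of n k] by (simp flip: smult_assoc)
      ultimately have "?d z (n + k) \<odot>\<^bsub>M\<^esub> (x \<oplus>\<^bsub>M\<^esub> y) = \<zero>\<^bsub>M\<^esub>"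
        using nk d(1)[OF z] x(1) y(1) by (simp add: smult_r_distr smult_r_zero)
      then show ?thesis by blast
    qed
    then show "x \<oplus>\<^bsub>M\<^esub> y \<in> primary_component q M \<nu>" using x y by (simp add: primary_component_def)
  next
    fix u x assume u: "u \<in> carrier (U_gh q)" and "x \<in> primary_component q M \<nu>"
    then have x: "x \<in> carrier M" "\<And>z. z \<in> Z_gh q \<Longrightarrow> \<exists>n. ?d z n \<odot>\<^bsub>M\<^esub> x = \<zero>\<^bsub>M\<^esub>"
      by (auto simp: primary_component_def)
    have "\<exists>n. ?d z n \<odot>\<^bsub>M\<^esub> (u \<odot>\<^bsub>M\<^esub> x) = \<zero>\<^bsub>M\<^esub>" if z: "z \<in> Z_gh q" for z
    proof -
      obtain n where n: "?d z n \<odot>\<^bsub>M\<^esub> x = \<zero>\<^bsub>M\<^esub>" using x(2)[OF z] by blast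
      obtain y where y: "u = cls q y" using u by (auto simp: carrier_U_gh)
      have "?d z n \<odot>\<^bsub>M\<^esub> (u \<odot>\<^bsub>M\<^esub> x) = u \<odot>\<^bsub>M\<^esub> (?d z n \<odot>\<^bsub>M\<^esub> x)"
        unfolding y by (rule central_act[OF d(2)[OF z] x(1), symmetric])
      then show ?thesis using n u by (auto simp: smult_r_zero)
    qed
    then show "u \<odot>\<^bsub>M\<^esub> x \<in> primary_component q M \<nu>"
      using x u by (simp add: primary_component_def smult_closed)
  }
qed

lemma primary_component_additive: "additive_subgroup (primary_component q M \<nu>) M"
  by (rule submodule_additive[OF primary_component_submodule])

lemma primary_components_independent:
  assumes \<nu>: "\<nu> \<in> central_chars q" and m: "m \<in> primary_component q M \<nu>"
    "m \<in> subgroup_sum M (central_chars q - {\<nu>}) (primary_component q M)"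
  shows "m = \<zero>\<^bsub>M\<^esub>"
proof (rule separated_subgroups_independent[of "central_chars q" "primary_component q M", OF _ _ \<nu> m])
  show "additive_subgroup (primary_component q M \<nu>) M" for \<nu> by (rule primary_component_additive)
next
  fix \<mu> \<nu> x
  assume "\<mu> \<in> central_chars q" "\<nu> \<in> central_chars q" "\<mu> \<noteq> \<nu>" and x: "x \<in> primary_component q M \<nu>"
  then obtain z where z: "z \<in> Z_gh q" "\<mu> z \<noteq> \<nu> z" using central_chars_differ by blast
  obtain n where n: "((z \<ominus>\<^bsub>U_gh q\<^esub> uscal q (\<nu> z)) [^]\<^bsub>U_gh q\<^esub> (n::nat)) \<odot>\<^bsub>M\<^esub> x = \<zero>\<^bsub>M\<^esub>"
    using x z(1) unfolding primary_component_def by blast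
  let ?d = "(z \<ominus>\<^bsub>U_gh q\<^esub> uscal q (\<nu> z)) [^]\<^bsub>U_gh q\<^esub> n"
  have d: "?d \<in> carrier (U_gh q)" using Z_gh_power_diff[OF z(1)] Z_gh_carrier by blast
  show "\<exists>a\<in>carrier (U_gh q). a \<odot>\<^bsub>M\<^esub> x = \<zero>\<^bsub>M\<^esub>
      \<and> (\<forall>\<mu>\<in>central_chars q. \<forall>y\<in>primary_component q M \<mu>. a \<odot>\<^bsub>M\<^esub> y \<in> primary_component q M \<mu>)
      \<and> (\<forall>y\<in>primary_component q M \<mu>. a \<odot>\<^bsub>M\<^esub> y = \<zero>\<^bsub>M\<^esub> \<longrightarrow> y = \<zero>\<^bsub>M\<^esub>)"
  proof (intro bexI[of _ ?d] conjI ballI impI n d)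
    fix \<mu> y assume "y \<in> primary_component q M \<mu>"
    then show "?d \<odot>\<^bsub>M\<^esub> y \<in> primary_component q M \<mu>"
      using primary_component_submodule d by (simp add: submodule_iff)
  next
    fix y assume y: "y \<in> primary_component q M \<mu>" "?d \<odot>\<^bsub>M\<^esub> y = \<zero>\<^bsub>M\<^esub>"
    obtain k where "((z \<ominus>\<^bsub>U_gh q\<^esub> uscal q (\<mu> z)) [^]\<^bsub>U_gh q\<^esub> (k::nat)) \<odot>\<^bsub>M\<^esub> y = \<zero>\<^bsub>M\<^esub>"
      using y(1) z(1) unfolding primary_component_def by blast
    then show "y = \<zero>\<^bsub>M\<^esub>"
      using y z distinct_generalized_eigenvalues[of y "\<mu> z" "\<nu> z" z k n] Z_gh_carrier[of q]
      by (auto simp: primary_component_def)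
  qed
qed

text \<open>
  A nonzero polynomial annihilating \<open>m\<close> splits off a power of a linear factor coprime to
  the rest, and a Bezout identity for the two factors splits \<open>m\<close> accordingly.
\<close>

lemma annihilated_vector_in_primary_sum:
  assumes C: "casimir q = cls q C" and m: "m \<in> gh_eigenspace b c"
    and p: "p \<noteq> 0" "peval C p \<cdot> m = \<zero>\<^bsub>M\<^esub>"
  shows "m \<in> subgroup_sum M (central_chars q) (primary_component q M)"
  using m p
proof (induction "degree p" arbitrary: p m rule: less_induct)
  case less
  let ?sum = "subgroup_sum M (central_chars q) (primary_component q M)"
  note PC = primary_component_additive
  have mc: "m \<in> carrier M" using less.prems(1) gh_eigenspace_carrier by blast
  show ?case
  proof (cases "degree p = 0")
    case True
    then obtain a where "p = [:a:]" by (auto elim: degree_eq_zeroE)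
    then have "m = \<zero>\<^bsub>M\<^esub>"
      using less.prems mc scalar_act_eq_zero[of m a] by (simp add: peval_pCons)
    then show ?thesis by (simp add: subgroup_sum.zero)
  next
    case False
    then obtain a where a: "poly p a = 0" using alg_closed_imp_poly_has_root[of p] by auto
    define n where "n = order a p"
    let ?l = "[:- a, 1:] ^ n"
    obtain r where r: "p = ?l * r" "\<not> [:- a, 1:] dvd r"
      using order_decomp[OF less.prems(2), of a] unfolding n_def by blast
    have ra: "poly r a \<noteq> 0" using r(2) by (simp add: poly_eq_0_iff_dvd)
    have r0: "r \<noteq> 0" using ra by auto
    have "n > 0" using a less.prems(2) order_root[of p a] by (simp add: n_def)
    then have deg: "degree r < degree p"
      unfolding r(1) using r0 by (subst degree_mult_eq) (auto simp: degree_linear_power)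
    obtain u v where uv: "u * ?l + v * r = 1" using linear_power_bezout[OF ra] .
    define m1 m2 where "m1 = peval C (u * ?l) \<cdot> m" and "m2 = peval C (v * r) \<cdot> m"
    have "m = peval C (u * ?l + v * r) \<cdot> m" using uv mc by (simp only: peval_1 act_one)
    then have split: "m = m1 \<oplus>\<^bsub>M\<^esub> m2" using mc by (simp add: m1_def m2_def peval_add act_add)
    have eig: "m1 \<in> gh_eigenspace b c" "m2 \<in> gh_eigenspace b c"
      using gh_eigenspace_act[OF less.prems(1)] by (auto simp: m1_def m2_def)
    have "peval C r \<cdot> m1 = peval C (u * p) \<cdot> m"
      using mc by (simp add: m1_def r(1) mult_ac flip: act_mult peval_mult)
    also have "\<dots> = \<zero>\<^bsub>M\<^esub>" using mc less.prems(3) by (simp add: peval_mult act_mult)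
    finally have m1: "m1 \<in> ?sum" using less.hyps[OF deg eig(1) r0] by blast
    have "peval C ?l \<cdot> m2 = peval C (v * p) \<cdot> m"
      using mc by (simp add: m2_def r(1) mult_ac flip: act_mult peval_mult)
    also have "\<dots> = \<zero>\<^bsub>M\<^esub>" using mc less.prems(3) by (simp add: peval_mult act_mult)
    finally have l2: "peval C ?l \<cdot> m2 = \<zero>\<^bsub>M\<^esub>" .
    have m2: "m2 \<in> ?sum"
    proof (cases "m2 = \<zero>\<^bsub>M\<^esub>")
      case True
      then show ?thesis by (simp add: subgroup_sum.zero)
    next
      case False
      then obtain \<nu> where "\<nu> \<in> central_chars q" "m2 \<in> primary_component q M \<nu>"
        using generalized_eigenvector_in_primary_component[OF C eig(2) False l2] by blast
      then show ?thesis
        using M.subgroup_sum_incl[of "primary_component q M" \<nu>] M.additive_subgroupD(1)[OF PC]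
        by blast
    qed
    show ?thesis
      unfolding split using m1 m2 M.additive_subgroupD(3)[OF M.subgroup_sum_additive_subgroup
          [of "central_chars q" "primary_component q M", OF PC]]
      by blast
  qed
qed

text \<open>
  The central element \<open>C\<close> preserves each weight space, and by finite dimension every weight
  vector is annihilated by a nonzero polynomial in \<open>C\<close>.
\<close>

lemma cat_O_primary_sum:
  assumes "M \<in> cat_O q"
  shows "carrier M \<subseteq> subgroup_sum M (central_chars q) (primary_component q M)"
proof -
  let ?sum = "subgroup_sum M (central_chars q) (primary_component q M)"
  obtain C where C: "casimir q = cls q C" by (simp add: casimir_def)
  have "m \<in> ?sum" if m: "m \<in> weight_space q M w" for m w
  proof -
    have "C \<cdot> v \<in> weight_space q M w" if "v \<in> weight_space q M w" for v
      using that central_act[OF central_casimir[OF q_nonzero q_square], of v]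
      unfolding weight_space_iff C by auto
    then obtain p where p: "p \<noteq> 0" "peval C p \<cdot> m = \<zero>\<^bsub>M\<^esub>"
      using annihilating_polynomial[of "weight_space q M w" C m] m weight_space_carrier assms
      unfolding cat_O_def by blast
    obtain a b c where w: "w = (a, b, c)" by (cases w)
    have "m \<in> gh_eigenspace b c" using m by (simp add: w weight_space_def gh_eigenspace_def)
    then show ?thesis using annihilated_vector_in_primary_sum[OF C _ p] by blast
  qed
  then have "subgroup_sum M {w\<in>UNIV. weight_space q M w \<noteq> {\<zero>\<^bsub>M\<^esub>}} (weight_space q M) \<subseteq> ?sum"
    by (intro M.subgroup_sum_least M.subgroup_sum_additive_subgroup primary_component_additive) auto
  moreover have "is_direct_sum M UNIV (weight_space q M)" using assms by (simp add: cat_O_def)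
  ultimately show ?thesis using is_direct_sum_generates[OF M.abelian_group_axioms] by blast
qed

end

text \<open>
  Finitely many generators involve only finitely many components; those already sum to \<open>M\<close>, and
  by independence no further component can be nonzero.
\<close>

lemma (in casimir_U_module) finitely_many_primary_components:
  assumes "M \<in> cat_O q"
  shows "finite {\<nu> \<in> central_chars q. primary_component q M \<nu> \<noteq> {\<zero>\<^bsub>M\<^esub>}}"
proof -
  let ?P = "primary_component q M"
  obtain S where S: "finite S" "S \<subseteq> carrier M" "carrier M = submodule_gen (U_gh q) M S"
    using assms by (auto simp: cat_O_def finitely_generated_def)
  have "\<forall>s\<in>S. \<exists>T. finite T \<and> T \<subseteq> central_chars q \<and> s \<in> subgroup_sum M T ?P"
  proof
    fix s assume "s \<in> S"
    then have "s \<in> subgroup_sum M (central_chars q) ?P"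
      using S(2) cat_O_primary_sum[OF assms] by blast
    then show "\<exists>T. finite T \<and> T \<subseteq> central_chars q \<and> s \<in> subgroup_sum M T ?P"
      by (rule subgroup_sum_finite)
  qed
  then obtain T where T: "\<And>s. s \<in> S \<Longrightarrow> finite (T s)" "\<And>s. s \<in> S \<Longrightarrow> T s \<subseteq> central_chars q"
    "\<And>s. s \<in> S \<Longrightarrow> s \<in> subgroup_sum M (T s) ?P" by metis
  define T' where "T' = (\<Union>s\<in>S. T s)"
  have T': "finite T'" "T' \<subseteq> central_chars q" using S(1) T(1,2) by (auto simp: T'_def)
  have "S \<subseteq> subgroup_sum M T' ?P"
  proof
    fix s assume s: "s \<in> S"
    show "s \<in> subgroup_sum M T' ?P"
      by (rule M.subgroup_sum_mono[OF T(3)[OF s]]) (use s in \<open>auto simp: T'_def\<close>)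
  qed
  then have gen: "carrier M \<subseteq> subgroup_sum M T' ?P"
    unfolding S(3) by (intro submodule_gen_least subgroup_sum_submodule primary_component_submodule)
  have "?P \<nu> = {\<zero>\<^bsub>M\<^esub>}" if \<nu>: "\<nu> \<in> central_chars q" "\<nu> \<notin> T'" for \<nu>
  proof -
    have "m = \<zero>\<^bsub>M\<^esub>" if m: "m \<in> ?P \<nu>" for m
    proof (rule primary_components_independent[OF \<nu>(1) m])
      have "m \<in> subgroup_sum M T' ?P" using gen m by (auto simp: primary_component_def)
      then show "m \<in> subgroup_sum M (central_chars q - {\<nu>}) ?P"
        by (rule M.subgroup_sum_mono) (use \<nu> T' in auto)
    qed
    then show ?thesis using M.additive_subgroupD(2)[OF primary_component_additive] by blast
  qed
  then have "{\<nu> \<in> central_chars q. ?P \<nu> \<noteq> {\<zero>\<^bsub>M\<^esub>}} \<subseteq> T'" by blast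
  then show ?thesis using T'(1) finite_subset by blast
qed

text \<open>
  The component is the image of \<open>M\<close> under the projection along the sum of the other components, so
  it inherits membership in category O.
\<close>

lemma (in casimir_U_module) primary_component_in_block:
  assumes "M \<in> cat_O q" and \<nu>: "\<nu> \<in> central_chars q"
  shows "M\<lparr>carrier := primary_component q M \<nu>\<rparr> \<in> cat_O_block q \<nu>"
proof -
  let ?P = "primary_component q M" and ?N = "M\<lparr>carrier := primary_component q M \<nu>\<rparr>"
  let ?B = "subgroup_sum M (central_chars q - {\<nu>}) ?P"
  have "\<exists>a\<in>?P \<nu>. \<exists>b\<in>?B. m = a \<oplus>\<^bsub>M\<^esub> b" if "m \<in> carrier M" for m
    using M.subgroup_sum_split[of "central_chars q" ?P \<nu> m, OF primary_component_additive \<nu>]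
      cat_O_primary_sum[OF assms(1)] that by blast
  moreover have "?P \<nu> \<inter> ?B \<subseteq> {\<zero>\<^bsub>M\<^esub>}" using primary_components_independent[OF \<nu>] by blast
  ultimately obtain p where p: "p \<in> left_module_hom (U_gh q) M ?N" "\<And>a. a \<in> ?P \<nu> \<Longrightarrow> p a = a"
    using projection_along_complement[of "?P \<nu>" ?B, OF primary_component_submodule
        subgroup_sum_submodule[OF primary_component_submodule]] by blast
  have N: "left_module (U_gh q) ?N"
    by (rule submodule_left_module[OF primary_component_submodule])
  interpret N: left_module "U_gh q" ?N by (rule N)
  have P_carrier: "?P \<nu> \<subseteq> carrier M" by (auto simp: primary_component_def)
  have img: "p ` carrier M = carrier ?N"
  proof
    show "p ` carrier M \<subseteq> carrier ?N"
      using left_module_hom_closed[OF left_module_axioms N p(1)] by blast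
    show "carrier ?N \<subseteq> p ` carrier M"
    proof
      fix a assume "a \<in> carrier ?N"
      then have "a = p a" "a \<in> carrier M" using p(2) P_carrier by auto
      then show "a \<in> p ` carrier M" by blast
    qed
  qed
  have "carrier ?N \<subseteq> subgroup_sum ?N {()} (\<lambda>_. p ` carrier M)"
    unfolding img using N.M.subgroup_sum_incl[of "\<lambda>_. carrier ?N" "()" "{()}"] by auto
  then have "?N \<in> cat_O q"
    using cat_O_sum_of_hom_images[of q ?N "{()}" "\<lambda>_. M" "\<lambda>_. p"] N p(1) assms(1) by blast
  moreover have "\<forall>m\<in>carrier ?N. \<forall>z\<in>Z_gh q. \<exists>n::nat.
       ((z \<ominus>\<^bsub>U_gh q\<^esub> uscal q (\<nu> z)) [^]\<^bsub>U_gh q\<^esub> n) \<odot>\<^bsub>?N\<^esub> m = \<zero>\<^bsub>?N\<^esub>"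
    by (simp add: primary_component_def)
  ultimately show ?thesis by (simp add: cat_O_block_def)
qed

text \<open>
  For \<open>z\<close> with \<open>\<mu> z \<noteq> \<nu> z\<close> the vector \<open>f m\<close> is a generalized eigenvector of \<open>z\<close> for both values.
\<close>

lemma block_homs_vanish:
  assumes "\<mu> \<in> central_chars q" "\<nu> \<in> central_chars q" "\<mu> \<noteq> \<nu>"
    and M: "M \<in> cat_O_block q \<mu>" and M': "M' \<in> cat_O_block q \<nu>"
    and f: "f \<in> left_module_hom (U_gh q) M M'" and m: "m \<in> carrier M"
  shows "f m = \<zero>\<^bsub>M'\<^esub>"
proof -
  have L: "left_module (U_gh q) M" "left_module (U_gh q) M'"
    using M M' by (auto simp: cat_O_block_def cat_O_def)
  interpret M': U_module q M' using L by (simp add: U_module_def)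
  obtain z where z: "z \<in> Z_gh q" "\<mu> z \<noteq> \<nu> z" using central_chars_differ[OF assms(1-3)] .
  have fm: "f m \<in> carrier M'" by (rule left_module_hom_closed[OF L f m])
  let ?d = "\<lambda>s n. (z \<ominus>\<^bsub>U_gh q\<^esub> uscal q s) [^]\<^bsub>U_gh q\<^esub> (n::nat)"
  obtain n where n: "?d (\<mu> z) n \<odot>\<^bsub>M\<^esub> m = \<zero>\<^bsub>M\<^esub>" using M m z(1) unfolding cat_O_block_def by blast
  obtain k where k: "?d (\<nu> z) k \<odot>\<^bsub>M'\<^esub> f m = \<zero>\<^bsub>M'\<^esub>"
    using M' fm z(1) unfolding cat_O_block_def by blast
  have "?d (\<mu> z) n \<odot>\<^bsub>M'\<^esub> f m = f (?d (\<mu> z) n \<odot>\<^bsub>M\<^esub> m)"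
    using left_module_hom_smult[OF L f _ m] Z_gh_power_diff[OF z(1)] Z_gh_carrier by (metis subsetD)
  also have "\<dots> = \<zero>\<^bsub>M'\<^esub>" using n left_module_hom_zero[OF L f] by simp
  finally show ?thesis
    using M'.distinct_generalized_eigenvalues[OF fm z(2) _ _ k] Z_gh_carrier z(1) by blast
qed

theorem theorem4p10:
  fixes q :: "'k::{alg_closed_field, field_char_0}"
  assumes "q \<noteq> 0" and "q\<^sup>2 \<noteq> 1"
    and "\<forall>n::nat. n > 0 \<longrightarrow> q ^ n \<noteq> 1"
  shows "(\<forall>M :: ('k free_gh set, 'm) module.
            M \<in> cat_O q \<longleftrightarrow>
              left_module (U_gh q) M
              \<and> (\<exists>N. is_direct_sum M (central_chars q) N
                    \<and> (\<forall>\<nu>\<in>central_chars q. M\<lparr>carrier := N \<nu>\<rparr> \<in> cat_O_block q \<nu>)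
                    \<and> finite {\<nu> \<in> central_chars q. N \<nu> \<noteq> {\<zero>\<^bsub>M\<^esub>}}))
       \<and> (\<forall>\<mu>\<in>central_chars q. \<forall>\<nu>\<in>central_chars q. \<mu> \<noteq> \<nu> \<longrightarrow>
            (\<forall>(M :: ('k free_gh set, 'm) module) (M' :: ('k free_gh set, 'n) module).
               M \<in> cat_O_block q \<mu> \<longrightarrow> M' \<in> cat_O_block q \<nu> \<longrightarrow>
                 (\<forall>f\<in>left_module_hom (U_gh q) M M'. \<forall>m\<in>carrier M. f m = \<zero>\<^bsub>M'\<^esub>)))"
proof (intro conjI allI ballI impI iffI)
  fix M :: "('k free_gh set, 'm) module"
  assume M: "M \<in> cat_O q"
  then show L: "left_module (U_gh q) M" by (simp add: cat_O_def)
  interpret casimir_U_module q M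
    using L assms by (simp add: casimir_U_module_def U_module_def casimir_U_module_axioms_def)
  have "is_direct_sum M (central_chars q) (primary_component q M)"
    by (rule is_direct_sumI[OF M.abelian_group_axioms primary_component_additive
          cat_O_primary_sum[OF M] primary_components_independent])
  then show "\<exists>N. is_direct_sum M (central_chars q) N
      \<and> (\<forall>\<nu>\<in>central_chars q. M\<lparr>carrier := N \<nu>\<rparr> \<in> cat_O_block q \<nu>)
      \<and> finite {\<nu> \<in> central_chars q. N \<nu> \<noteq> {\<zero>\<^bsub>M\<^esub>}}"
    using primary_component_in_block[OF M] finitely_many_primary_components[OF M] by blast
next
  fix M :: "('k free_gh set, 'm) module"
  assume "left_module (U_gh q) M
      \<and> (\<exists>N. is_direct_sum M (central_chars q) N
            \<and> (\<forall>\<nu>\<in>central_chars q. M\<lparr>carrier := N \<nu>\<rparr> \<in> cat_O_block q \<nu>)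
            \<and> finite {\<nu> \<in> central_chars q. N \<nu> \<noteq> {\<zero>\<^bsub>M\<^esub>}})"
  then obtain N where L: "left_module (U_gh q) M" and sum: "is_direct_sum M (central_chars q) N"
    and block: "\<And>\<nu>. \<nu> \<in> central_chars q \<Longrightarrow> M\<lparr>carrier := N \<nu>\<rparr> \<in> cat_O_block q \<nu>"
    and fin: "finite {\<nu> \<in> central_chars q. N \<nu> \<noteq> {\<zero>\<^bsub>M\<^esub>}}" by blast
  interpret left_module "U_gh q" M by (rule L)
  have N: "N \<nu> \<subseteq> carrier M" if "\<nu> \<in> central_chars q" for \<nu>
    using sum that M.additive_subgroupD(1) by (auto simp: is_direct_sum_def)
  show "M \<in> cat_O q"
  proof (rule cat_O_sum_of_hom_images[OF L fin])
    fix \<nu> assume "\<nu> \<in> {\<nu> \<in> central_chars q. N \<nu> \<noteq> {\<zero>\<^bsub>M\<^esub>}}"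
    then have \<nu>: "\<nu> \<in> central_chars q" by simp
    show "M\<lparr>carrier := N \<nu>\<rparr> \<in> cat_O q" using block[OF \<nu>] by (simp add: cat_O_block_def)
    show "(\<lambda>x. x) \<in> left_module_hom (U_gh q) (M\<lparr>carrier := N \<nu>\<rparr>) M"
      by (rule submodule_inclusion_hom[OF N[OF \<nu>]])
  next
    show "carrier M \<subseteq> subgroup_sum M {\<nu> \<in> central_chars q. N \<nu> \<noteq> {\<zero>\<^bsub>M\<^esub>}}
        (\<lambda>\<nu>. (\<lambda>x. x) ` carrier (M\<lparr>carrier := N \<nu>\<rparr>))"
      using is_direct_sum_generates[OF M.abelian_group_axioms sum] by simp
  qed
qed (rule block_homs_vanish)

end
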